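(* Let $\mathcal{G}$ be a locally compact non-compact group and let $\mathcal{X}$ be a $\mathcal{G}$-space. If $\mathcal{G}$ does not act effectively on $\mathcal{X}$, then $M(\mathcal{G})$ is properly contained in $\mathfrak{Z}(\mathcal{X},\mathcal{G})$.
   Context: A (left) $\mathcal{G}$-space is a locally compact Hausdorff space $\mathcal{X}$ with a continuous map $\mathcal{G}\times\mathcal{X}\to\mathcal{X}$, $(s,x)\mapsto s\cdot x$, such that $(st)\cdot x=s\cdot(t\cdot x)$ and $e\cdot x=x$ for all $s,t\in\mathcal{G}$, $x\in\mathcal{X}$, where $e$ is the identity of $\mathcal{G}$. The action is effective if $\mathfrak{N}(\mathcal{X},\mathcal{G})=\{s\in\mathcal{G}: s\cdot x=x \text{ for all } x\in\mathcal{X}\}$ equals $\{e\}$. $C_b(\mathcal{X})$ is the space of bounded continuous complex-valued functions on $\mathcal{X}$ with the supremum norm. For $F\in C_b(\mathcal{X})$ and $s\in\mathcal{G}$ put $(l_sF)(x)=F(s\cdot x)$, and let $$LUC(\mathcal{X},\mathcal{G})=\{F\in C_b(\mathcal{X}): s\mapsto l_sF \text{ is continuous from } \mathcal{G} \text{ into } (C_b(\mathcal{X}),\|\cdot\|_\infty)\},$$ a closed subspace of $C_b(\mathcal{X})$ invariant under all $l_s$. $LUC(\mathcal{G})=LUC(\mathcal{G},\mathcal{G})$, with $\mathcal{G}$ acting on itself by left translation. $M(\mathcal{G})$, the space of complex regular Borel measures on $\mathcal{G}$, is viewed as a subspace of $LUC(\mathcal{G})^*$ via $\langle\mu,f\rangle=\int_{\mathcal{G}}f\,d\mu$.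 For $M\in LUC(\mathcal{X},\mathcal{G})^*$ and $F\in LUC(\mathcal{X},\mathcal{G})$, the function $MF\in LUC(\mathcal{G})$ is given by $(MF)(s)=\langle M,l_sF\rangle$. For $m\in LUC(\mathcal{G})^*$, the functional $m\cdot M\in LUC(\mathcal{X},\mathcal{G})^*$ is given by $\langle m\cdot M,F\rangle=\langle m,MF\rangle$. Define $$\mathfrak{Z}(\mathcal{X},\mathcal{G})=\{m\in LUC(\mathcal{G})^*: M\mapsto m\cdot M \text{ is weak}^*\text{ to weak}^*\text{ continuous on } LUC(\mathcal{X},\mathcal{G})^*\}.$$ *)

theory Defs
  imports "HOL-Analysis.Analysis"
begin

text \<open>
  The acting group is a type of class \<open>topological_group_add\<close>. That class does not assume
  commutativity; only the notation is additive: \<open>s + t\<close> is the product \<open>st\<close>, \<open>0\<close> is the identity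
  \<open>e\<close>, and \<open>(+)\<close> is the action of the group on itself by left translation.
  The elements of \<open>C\<^sub>b(X)\<close> are the members of the type \<open>'x \<Rightarrow>\<^sub>C complex\<close>, which carries the
  supremum norm.
\<close>

subsection \<open>Spaces with a group action\<close>

definition g_space :: "('g::{topological_group_add,t2_space} \<Rightarrow> 'x::t2_space \<Rightarrow> 'x) \<Rightarrow> bool" where
  "g_space act \<longleftrightarrow>
     locally_compact_space (euclidean :: 'x topology) \<and>
     continuous_on UNIV (\<lambda>(s, x). act s x) \<and>
     (\<forall>s t x. act (s + t) x = act s (act t x)) \<and>
     (\<forall>x. act 0 x = x)"

definition action_kernel :: "('g \<Rightarrow> 'x \<Rightarrow> 'x) \<Rightarrow> 'g set" where
  "action_kernel act = {s. \<forall>x. act s x = x}"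

definition effective :: "('g::{topological_group_add,t2_space} \<Rightarrow> 'x::t2_space \<Rightarrow> 'x) \<Rightarrow> bool" where
  "effective act \<longleftrightarrow> action_kernel act = {0}"


subsection \<open>The space \<open>LUC\<close> and its dual\<close>

definition translate ::
    "('g \<Rightarrow> 'x \<Rightarrow> 'x) \<Rightarrow> 'g \<Rightarrow> ('x::t2_space \<Rightarrow>\<^sub>C complex) \<Rightarrow> ('x \<Rightarrow>\<^sub>C complex)" where
  "translate act s F = Bcontfun (\<lambda>x. apply_bcontfun F (act s x))"

definition LUC ::
    "('g::{topological_group_add,t2_space} \<Rightarrow> 'x::t2_space \<Rightarrow> 'x) \<Rightarrow> ('x \<Rightarrow>\<^sub>C complex) set" where
  "LUC act = {F. continuous_on UNIV (\<lambda>s. translate act s F)}"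

text \<open>The library makes \<open>'x \<Rightarrow>\<^sub>C complex\<close> a real normed space only.\<close>

definition cscale :: "complex \<Rightarrow> ('x::t2_space \<Rightarrow>\<^sub>C complex) \<Rightarrow> ('x \<Rightarrow>\<^sub>C complex)" where
  "cscale c F = Bcontfun (\<lambda>x. c * apply_bcontfun F x)"

text \<open>
  Complex-linear bounded functionals on a subspace \<open>L\<close> of \<open>C\<^sub>b(X)\<close>. Being functions on \<open>L\<close> only,
  they are represented by functions that are \<open>undefined\<close> outside \<open>L\<close>.
\<close>

definition dual :: "('x::t2_space \<Rightarrow>\<^sub>C complex) set \<Rightarrow> (('x \<Rightarrow>\<^sub>C complex) \<Rightarrow> complex) set" where
  "dual L = {M \<in> extensional L.
     (\<forall>F\<in>L. \<forall>H\<in>L. M (F + H) = M F + M H) \<and>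
     (\<forall>c. \<forall>F\<in>L. M (cscale c F) = c * M F) \<and>
     (\<exists>B. \<forall>F\<in>L. norm (M F) \<le> B * norm F)}"

text \<open>The weak* topology is the topology of pointwise convergence on \<open>L\<close>.\<close>

definition weak_star ::
    "('x::t2_space \<Rightarrow>\<^sub>C complex) set \<Rightarrow> (('x \<Rightarrow>\<^sub>C complex) \<Rightarrow> complex) topology" where
  "weak_star L = subtopology (product_topology (\<lambda>_. euclidean) L) (dual L)"


subsection \<open>The module action and the set \<open>Z(X,G)\<close>\<close>

text \<open>\<open>orbit_fun act M F\<close> is the function \<open>MF\<close>, and \<open>module_act act m M\<close> is \<open>m \<cdot> M\<close>.\<close>

definition orbit_fun ::
    "('g::{topological_group_add,t2_space} \<Rightarrow> 'x::t2_space \<Rightarrow> 'x) \<Rightarrow>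
      (('x \<Rightarrow>\<^sub>C complex) \<Rightarrow> complex) \<Rightarrow> ('x \<Rightarrow>\<^sub>C complex) \<Rightarrow> ('g \<Rightarrow>\<^sub>C complex)" where
  "orbit_fun act M F = Bcontfun (\<lambda>s. M (translate act s F))"

definition module_act ::
    "('g::{topological_group_add,t2_space} \<Rightarrow> 'x::t2_space \<Rightarrow> 'x) \<Rightarrow>
      (('g \<Rightarrow>\<^sub>C complex) \<Rightarrow> complex) \<Rightarrow> (('x \<Rightarrow>\<^sub>C complex) \<Rightarrow> complex) \<Rightarrow>
      (('x \<Rightarrow>\<^sub>C complex) \<Rightarrow> complex)" where
  "module_act act m M = restrict (\<lambda>F. m (orbit_fun act M F)) (LUC act)"

definition top_centre ::
    "('g::{topological_group_add,t2_space} \<Rightarrow> 'x::t2_space \<Rightarrow> 'x) \<Rightarrow>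
      (('g \<Rightarrow>\<^sub>C complex) \<Rightarrow> complex) set" where
  "top_centre act = {m \<in> dual (LUC (+)).
     continuous_map (weak_star (LUC act)) (weak_star (LUC act)) (module_act act m)}"


subsection \<open>Complex regular Borel measures\<close>

text \<open>
  A complex Borel measure is a countably additive complex-valued function on the Borel sets; its
  values on other sets are irrelevant.
\<close>

definition complex_borel_measure :: "('g::topological_space set \<Rightarrow> complex) \<Rightarrow> bool" where
  "complex_borel_measure \<mu> \<longleftrightarrow>
     (\<forall>A :: nat \<Rightarrow> 'g set. range A \<subseteq> sets borel \<longrightarrow> disjoint_family A \<longrightarrow>
        (\<lambda>n. \<mu> (A n)) sums \<mu> (\<Union>n. A n))"

definition total_variation :: "('g::topological_space set \<Rightarrow> complex) \<Rightarrow> 'g set \<Rightarrow> ennreal" where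
  "total_variation \<mu> E =
     (SUP A \<in> {A :: nat \<Rightarrow> 'g set. range A \<subseteq> sets borel \<and> disjoint_family A \<and> (\<Union>n. A n) = E}.
        \<Sum>n. ennreal (norm (\<mu> (A n))))"

definition regular_measure :: "('g::topological_space set \<Rightarrow> complex) \<Rightarrow> bool" where
  "regular_measure \<mu> \<longleftrightarrow> (\<forall>E \<in> sets borel.
     total_variation \<mu> E = (INF U \<in> {U. open U \<and> E \<subseteq> U}. total_variation \<mu> U) \<and>
     total_variation \<mu> E = (SUP K \<in> {K. compact K \<and> K \<subseteq> E}. total_variation \<mu> K))"

text \<open>
  The positive variation \<open>\<nu>\<^sup>+(E) = sup {\<nu>(B) | B \<subseteq> E}\<close> of a finite signed measure, so that
  \<open>\<nu> = \<nu>\<^sup>+ - (- \<nu>)\<^sup>+\<close> is the Jordan decomposition. The set \<open>B = {}\<close> makes the supremum nonnegative,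
  hence it does not matter that \<open>ennreal\<close> maps negative reals to \<open>0\<close>.
\<close>

definition positive_part :: "('g::topological_space set \<Rightarrow> real) \<Rightarrow> 'g measure" where
  "positive_part \<nu> = measure_of UNIV (sets borel)
     (\<lambda>E. SUP B \<in> {B \<in> sets borel. B \<subseteq> E}. ennreal (\<nu> B))"

definition signed_integral ::
    "('g::topological_space set \<Rightarrow> real) \<Rightarrow> ('g \<Rightarrow> complex) \<Rightarrow> complex" where
  "signed_integral \<nu> f =
     integral\<^sup>L (positive_part \<nu>) f - integral\<^sup>L (positive_part (\<lambda>E. - \<nu> E)) f"

definition complex_integral ::
    "('g::topological_space set \<Rightarrow> complex) \<Rightarrow> ('g \<Rightarrow> complex) \<Rightarrow> complex" where
  "complex_integral \<mu> f =
     signed_integral (\<lambda>E. Re (\<mu> E)) f + \<i> * signed_integral (\<lambda>E. Im (\<mu> E)) f"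

text \<open>The space \<open>M(G)\<close>, as a set of functionals on \<open>LUC(G)\<close>.\<close>

definition measure_functional ::
    "('g::{topological_group_add,t2_space} set \<Rightarrow> complex) \<Rightarrow> (('g \<Rightarrow>\<^sub>C complex) \<Rightarrow> complex)" where
  "measure_functional \<mu> = restrict (\<lambda>f. complex_integral \<mu> (apply_bcontfun f)) (LUC (+))"

definition measure_functionals ::
    "(('g::{topological_group_add,t2_space} \<Rightarrow>\<^sub>C complex) \<Rightarrow> complex) set" where
  "measure_functionals =
     measure_functional ` {\<mu>. complex_borel_measure \<mu> \<and> regular_measure \<mu>}"


subsection \<open>The functions passed to \<open>Bcontfun\<close> are bounded and continuous\<close>

lemma apply_cscale [simp]: "apply_bcontfun (cscale c F) x = c * apply_bcontfun F x"
proof -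
  have "bounded ((\<lambda>z. c * z) ` range (apply_bcontfun F))"
    by (intro bounded_linear_image bounded_linear_mult_right) simp
  then have "(\<lambda>x. c * apply_bcontfun F x) \<in> bcontfun"
    by (auto simp: bcontfun_def image_image intro!: continuous_intros)
  then show ?thesis
    by (simp add: cscale_def Bcontfun_inverse)
qed

lemma g_space_continuous:
  assumes "g_space act"
  shows "continuous_on UNIV (act s)"
proof -
  have "continuous_on UNIV ((\<lambda>(s, x). act s x) \<circ> Pair s)"
    using assms unfolding g_space_def
    by (intro continuous_on_compose continuous_intros) (auto elim: continuous_on_subset)
  then show ?thesis
    by (simp add: o_def)
qed

lemma apply_translate:
  assumes "g_space act"
  shows "apply_bcontfun (translate act s F) x = apply_bcontfun F (act s x)"
proof -
  have "continuous_on UNIV (apply_bcontfun F \<circ> act s)"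
    by (intro continuous_on_compose g_space_continuous assms) simp
  moreover have "bounded (range (\<lambda>x. apply_bcontfun F (act s x)))"
    by (rule bounded_subset[OF bounded_apply_bcontfun[of F]]) auto
  ultimately have "(\<lambda>x. apply_bcontfun F (act s x)) \<in> bcontfun"
    by (simp add: bcontfun_def o_def)
  then show ?thesis
    by (simp add: translate_def Bcontfun_inverse)
qed

lemma translate_translate:
  assumes "g_space act"
  shows "translate act t (translate act s F) = translate act (s + t) F"
  using assms by (intro bcontfun_eqI) (simp add: apply_translate g_space_def)

lemma translate_in_LUC:
  assumes "g_space act" "F \<in> LUC act"
  shows "translate act s F \<in> LUC act"
proof -
  have "continuous_on UNIV ((\<lambda>t. translate act t F) \<circ> (\<lambda>t. s + t))"
    using assms(2) unfolding LUC_def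
    by (intro continuous_on_compose continuous_intros) (auto elim: continuous_on_subset)
  then show ?thesis
    by (simp add: LUC_def translate_translate[OF assms(1)] o_def)
qed

lemma norm_translate_le:
  assumes "g_space act"
  shows "norm (translate act s F) \<le> norm F"
  by (rule norm_bound) (simp add: apply_translate[OF assms] norm_bounded)

lemma diff_in_LUC:
  assumes "g_space act" "F \<in> LUC act" "H \<in> LUC act"
  shows "F - H \<in> LUC act"
proof -
  have "translate act s (F - H) = translate act s F - translate act s H" for s
    by (rule bcontfun_eqI) (simp add: apply_translate[OF assms(1)])
  with assms show ?thesis
    by (auto simp: LUC_def intro: continuous_intros)
qed

lemma apply_orbit_fun:
  assumes G: "g_space act" and M: "M \<in> dual (LUC act)" and F: "F \<in> LUC act"
  shows "apply_bcontfun (orbit_fun act M F) s = M (translate act s F)"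
proof -
  obtain B where "\<forall>H\<in>LUC act. norm (M H) \<le> B * norm H"
    using M by (auto simp: dual_def)
  then have B: "norm (M H) \<le> \<bar>B\<bar> * norm H" if "H \<in> LUC act" for H
    using that by (meson abs_ge_self mult_right_mono norm_ge_zero order_trans)
  have diff: "M H - M K = M (H - K)" if "H \<in> LUC act" "K \<in> LUC act" for H K
  proof -
    have "M ((H - K) + K) = M (H - K) + M K"
      using M that(2) diff_in_LUC[OF G that] unfolding dual_def by blast
    then show ?thesis by simp
  qed
  have "continuous_on UNIV (\<lambda>s. M (translate act s F))"
    unfolding continuous_on_def
  proof
    fix t
    have "((\<lambda>s. translate act s F) \<longlongrightarrow> translate act t F) (at t)"
      using F by (auto simp: LUC_def continuous_on_def)
    then have "((\<lambda>s. \<bar>B\<bar> * norm (translate act s F - translate act t F)) \<longlongrightarrow> 0) (at t)"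
      by (auto intro!: tendsto_eq_intros)
    then have "((\<lambda>s. M (translate act s F) - M (translate act t F)) \<longlongrightarrow> 0) (at t)"
      by (rule Lim_null_comparison[rotated])
        (auto intro!: always_eventually B diff_in_LUC translate_in_LUC G F
          simp: diff[OF translate_in_LUC[OF G F] translate_in_LUC[OF G F]])
    then show "((\<lambda>s. M (translate act s F)) \<longlongrightarrow> M (translate act t F)) (at t within UNIV)"
      by (simp add: Lim_null[symmetric])
  qed
  moreover have "norm (M (translate act s F)) \<le> \<bar>B\<bar> * norm F" for s
    using B[OF translate_in_LUC[OF G F]] norm_translate_le[OF G]
    by (meson abs_ge_zero mult_left_mono order_trans)
  then have "bounded (range (\<lambda>s. M (translate act s F)))"
    by (auto simp: bounded_iff)
  ultimately show ?thesis
    by (simp add: orbit_fun_def bcontfun_def Bcontfun_inverse)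
qed

end

theory Submission
  imports Defs
begin

text \<open>
  For \<open>\<mu> \<in> M(G)\<close> and \<open>F \<in> LUC(X,G)\<close> the integral \<open>H\<close> of the bounded norm continuous map \<open>s \<mapsto> l\<^sub>s F\<close>
  with respect to \<open>\<mu>\<close> lies in \<open>LUC(X,G)\<close>, because \<open>\<mu>\<close> is tight. Since \<open>\<langle>\<mu> \<cdot> M, F\<rangle> = \<langle>M, H\<rangle>\<close>, the map
  \<open>M \<mapsto> \<mu> \<cdot> M\<close> is weak* continuous.

  If \<open>n \<noteq> e\<close> acts trivially on \<open>X\<close>, every function \<open>MF\<close> is invariant under translation by \<open>n\<close>. So a
  functional \<open>m\<close> that vanishes on the \<open>n\<close>-invariant functions satisfies \<open>m \<cdot> M = 0\<close> for all \<open>M\<close> and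
  belongs to \<open>Z(X,G)\<close>. Such an \<open>m\<close> is obtained as a limit of \<open>f \<mapsto> f(s) - f(ns)\<close> with \<open>s\<close> tending to
  infinity in a suitable set \<open>S\<close>. It annihilates the functions of compact support, hence it could
  come from a regular measure only if it were \<open>0\<close>; but \<open>m\<close> takes the value \<open>1\<close> at a function that is
  \<open>1\<close> on \<open>S\<close> and \<open>0\<close> on \<open>nS\<close>. If \<open>\<phi>\<close> is a bump function at \<open>e\<close> with \<open>\<phi>(n) = 0\<close> and \<open>S\<close> is maximal
  among the sufficiently separated sets, then \<open>x \<mapsto> sup {\<phi>(x s\<^sup>-\<^sup>1) | s \<in> S}\<close> is such a function, and
  \<open>S\<close> is not relatively compact because \<open>G\<close> is not compact.
\<close>

subsection \<open>Complex measures\<close>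

text \<open>The real and imaginary parts of a complex measure are of this kind, and so are their
  negatives; \<open>complex_integral\<close> is built from the positive variations of these
  four.\<close>

definition signed_measure :: "('g::topological_space set \<Rightarrow> real) \<Rightarrow> bool" where
  "signed_measure \<nu> \<longleftrightarrow>
     (\<forall>A :: nat \<Rightarrow> 'g set. range A \<subseteq> sets borel \<longrightarrow> disjoint_family A \<longrightarrow>
        (\<lambda>n. \<nu> (A n)) sums \<nu> (\<Union>n. A n))"

lemma signed_measure_empty:
  assumes "signed_measure \<nu>"
  shows "\<nu> {} = 0"
proof -
  have "(\<lambda>n::nat. \<nu> {}) sums \<nu> (\<Union>n::nat. {})"
    using assms[unfolded signed_measure_def, rule_format, of "\<lambda>n. {}"] by (simp add: disjoint_family_on_def)
  then show ?thesis
    using sums_summable summable_const_iff by blast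
qed

lemma signed_measure_Un:
  assumes "signed_measure \<nu>" "A \<in> sets borel" "B \<in> sets borel" "A \<inter> B = {}"
  shows "\<nu> (A \<union> B) = \<nu> A + \<nu> B"
proof -
  have "(\<lambda>n. \<nu> (binaryset A B n)) sums \<nu> (\<Union>n. binaryset A B n)"
    using assms by (intro assms(1)[unfolded signed_measure_def, rule_format])
      (auto simp: range_binaryset_eq disjoint_family_on_def binaryset_def)
  moreover have "(\<lambda>n. \<nu> (binaryset A B n)) sums (\<nu> A + \<nu> B)"
    by (rule binaryset_sums) (rule signed_measure_empty[OF assms(1)])
  ultimately show ?thesis
    by (simp add: UN_binaryset_eq sums_unique2)
qed

lemma signed_measure_Diff:
  assumes "signed_measure \<nu>" "A \<in> sets borel" "B \<in> sets borel" "B \<subseteq> A"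
  shows "\<nu> (A - B) = \<nu> A - \<nu> B"
  using signed_measure_Un[OF assms(1), of B "A - B"] assms by (simp add: Un_absorb1)

lemma signed_measure_UN_finite:
  assumes "signed_measure \<nu>" "finite I" "\<And>i. i \<in> I \<Longrightarrow> A i \<in> sets borel" "disjoint_family_on A I"
  shows "\<nu> (\<Union>i\<in>I. A i) = (\<Sum>i\<in>I. \<nu> (A i))"
  using assms(2,3,4)
proof (induction I)
  case empty
  then show ?case by (simp add: signed_measure_empty[OF assms(1)])
next
  case (insert i I)
  have "A i \<inter> (\<Union>i\<in>I. A i) = {}"
    using insert.prems(2) insert.hyps(2) by (auto simp: disjoint_family_on_def)
  then have "\<nu> (A i \<union> (\<Union>i\<in>I. A i)) = \<nu> (A i) + \<nu> (\<Union>i\<in>I. A i)"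
    using insert.hyps insert.prems by (intro signed_measure_Un[OF assms(1)]) auto
  with insert show ?case by (auto simp: disjoint_family_on_def)
qed

lemma signed_measure_uminus:
  "signed_measure \<nu> \<Longrightarrow> signed_measure (\<lambda>E. - \<nu> E)"
  by (auto simp: signed_measure_def intro: sums_minus)

lemma complex_borel_measure_Re_Im:
  assumes "complex_borel_measure \<mu>"
  shows "signed_measure (\<lambda>E. Re (\<mu> E))" "signed_measure (\<lambda>E. Im (\<mu> E))"
  using assms by (auto simp: complex_borel_measure_def signed_measure_def intro: sums_Re sums_Im)

text \<open>If \<open>\<nu>\<close> were unbounded on the subsets of \<open>E\<close>, one could split off a set of measure at least
  \<open>1\<close> in absolute value so that \<open>\<nu>\<close> is still unbounded on the subsets of the remainder, and so on.\<close>

lemma signed_measure_bounded: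
  assumes nu: "signed_measure \<nu>"
  obtains C where "\<And>B. B \<in> sets borel \<Longrightarrow> \<bar>\<nu> B\<bar> \<le> C"
proof (rule ccontr)
  assume no: "\<not> thesis"
  have unb: "\<exists>B\<in>sets borel. C < \<bar>\<nu> B\<bar>" for C
    using no that[of C] not_less by blast
  define bad where "bad E \<longleftrightarrow> E \<in> sets borel \<and> (\<forall>C. \<exists>B\<in>sets borel. B \<subseteq> E \<and> \<bar>\<nu> B\<bar> > C)" for E
  have "bad UNIV"
    unfolding bad_def using unb by simp
  have step: "\<exists>E'. bad E' \<and> E' \<subseteq> E \<and> 1 \<le> \<bar>\<nu> (E - E')\<bar>" if badE: "bad E" for E
  proof -
    obtain B where B: "B \<in> sets borel" "B \<subseteq> E" "\<bar>\<nu> B\<bar> > \<bar>\<nu> E\<bar> + 1"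
      using badE unfolding bad_def by metis
    have E: "E \<in> sets borel"
      using that by (simp add: bad_def)
    have d: "\<nu> (E - B) = \<nu> E - \<nu> B"
      using signed_measure_Diff[OF nu E B(1,2)] .
    have "bad B \<or> bad (E - B)"
    proof (rule ccontr)
      assume "\<not> ?thesis"
      then obtain C1 C2 where
        C: "\<And>D. D \<in> sets borel \<Longrightarrow> D \<subseteq> B \<Longrightarrow> \<not> C1 < \<bar>\<nu> D\<bar>"
           "\<And>D. D \<in> sets borel \<Longrightarrow> D \<subseteq> E - B \<Longrightarrow> \<not> C2 < \<bar>\<nu> D\<bar>"
        using B(1) sets.Diff[OF E B(1)] unfolding bad_def by metis
      obtain D where D: "D \<in> sets borel" "D \<subseteq> E" "\<bar>\<nu> D\<bar> > C1 + C2"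
        using badE unfolding bad_def by metis
      have "\<nu> D = \<nu> (D \<inter> B) + \<nu> (D - B)"
        using signed_measure_Un[OF nu, of "D \<inter> B" "D - B"] B D by (simp add: Int_Diff_Un Diff_disjoint Int_assoc)
      moreover have "\<bar>\<nu> (D \<inter> B)\<bar> \<le> C1" "\<bar>\<nu> (D - B)\<bar> \<le> C2"
        using C(1)[of "D \<inter> B"] C(2)[of "D - B", OF _ Diff_mono] B D by auto
      ultimately show False
        using D(3) by linarith
    qed
    then show ?thesis
    proof
      assume "bad B"
      with B d show ?thesis by (intro exI[of _ B]) auto
    next
      assume *: "bad (E - B)"
      have "E - (E - B) = B" using B(2) by auto
      with B * show ?thesis by (intro exI[of _ "E - B"]) auto
    qed
  qed
  obtain E where E: "\<And>n. bad (E n)" "\<And>n. E (Suc n) \<subseteq> E n \<and> 1 \<le> \<bar>\<nu> (E n - E (Suc n))\<bar>"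
  proof -
    have "\<exists>E. \<forall>n. bad (E n) \<and> (E (Suc n) \<subseteq> E n \<and> 1 \<le> \<bar>\<nu> (E n - E (Suc n))\<bar>)"
      by (rule dependent_nat_choice) (use \<open>bad UNIV\<close> step in simp_all, metis)
    then show ?thesis using that by metis
  qed
  \<comment> \<open>The pieces split off are disjoint, so countable additivity makes their measures
    a convergent series, although no term is below 1 in absolute value.\<close>
  define A where "A n = E n - E (Suc n)" for n
  have dec: "decseq E"
    using E(2) by (auto simp: decseq_Suc_iff)
  have "disjoint_family A"
  proof -
    have "A m \<inter> A n = {}" if "m < n" for m n
      using decseqD[OF dec, of "Suc m" n] that by (auto simp: A_def)
    then show ?thesis
      unfolding disjoint_family_on_def by (metis Int_commute linorder_neqE_nat)
  qed
  moreover have "range A \<subseteq> sets borel"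
    using E(1) by (auto simp: A_def bad_def)
  ultimately have "summable (\<lambda>n. \<nu> (A n))"
    using nu unfolding signed_measure_def by (metis sums_summable)
  then have "(\<lambda>n. \<nu> (A n)) \<longlonglongrightarrow> 0"
    by (rule summable_LIMSEQ_zero)
  then have "eventually (\<lambda>n. norm (\<nu> (A n)) < 1) sequentially"
    using tendstoD[of "\<lambda>n. \<nu> (A n)" 0 sequentially 1] by simp
  moreover have "\<not> norm (\<nu> (A n)) < 1" for n
    using E(2)[of n] by (simp add: A_def not_less)
  ultimately show False
    by simp
qed

section \<open>The positive variation as a finite Borel measure\<close>

lemma sum_ennreal_ge: "ennreal (sum f I) \<le> (\<Sum>i\<in>I. ennreal (f i))"
proof (cases "finite I")
  case True
  then show ?thesis
  proof (induction I)
    case (insert i I)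
    have "ennreal (f i + sum f I) \<le> ennreal (f i) + ennreal (sum f I)"
    proof -
      consider "f i \<le> 0" | "sum f I \<le> 0" | "f i \<ge> 0" "sum f I \<ge> 0" by linarith
      then show ?thesis
      proof cases
        case 1
        then show ?thesis by (simp add: ennreal_neg ennreal_leI)
      next
        case 2
        then show ?thesis by (simp add: ennreal_neg ennreal_leI)
      qed (simp add: ennreal_plus)
    qed
    with insert show ?case
      by (simp add: add_left_mono order_trans)
  qed simp
qed simp

text \<open>The union of a competitor for \<open>A\<close> and one for \<open>B\<close> is a
  competitor for \<open>A \<union> B\<close>. If one of the two has negative measure,
  \<open>ennreal\<close> truncates it to 0 and the other one alone suffices.\<close>

lemma positive_variation_superadditive:
  assumes nu: "signed_measure \<nu>" and "A \<inter> B = {}"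
  defines "p \<equiv> \<lambda>E. SUP D \<in> {D \<in> sets borel. D \<subseteq> E}. ennreal (\<nu> D)"
  shows "p A + p B \<le> p (A \<union> B)"
proof -
  have *: "ennreal (\<nu> D) + ennreal (\<nu> E) \<le> p (A \<union> B)"
    if "D \<in> sets borel" "D \<subseteq> A" "E \<in> sets borel" "E \<subseteq> B" for D E
  proof -
    have ub: "ennreal (\<nu> C) \<le> p (A \<union> B)" if "C \<in> sets borel" "C \<subseteq> A \<union> B" for C
      unfolding p_def by (rule SUP_upper) (use that in auto)
    consider "\<nu> D \<le> 0" | "\<nu> E \<le> 0" | "\<nu> D \<ge> 0" "\<nu> E \<ge> 0" by linarith
    then show ?thesis
    proof cases
      case 1
      then show ?thesis using ub[of E] that by (auto simp: ennreal_neg)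
    next
      case 2
      then show ?thesis using ub[of D] that by (auto simp: ennreal_neg)
    next
      case 3
      have "\<nu> (D \<union> E) = \<nu> D + \<nu> E"
        using that assms(2) by (intro signed_measure_Un[OF nu]) auto
      with 3 have "ennreal (\<nu> D) + ennreal (\<nu> E) = ennreal (\<nu> (D \<union> E))"
        by (simp add: ennreal_plus)
      also have "\<dots> \<le> p (A \<union> B)"
        using that by (intro ub) auto
      finally show ?thesis .
    qed
  qed
  have ne: "{D \<in> sets borel. D \<subseteq> E} \<noteq> {}" for E :: "'a set"
    by blast
  have "p A + p B = (SUP D \<in> {D \<in> sets borel. D \<subseteq> A}. ennreal (\<nu> D) + p B)"
    by (simp only: p_def ennreal_SUP_add_left[OF ne])
  also have "\<dots> = (SUP D \<in> {D \<in> sets borel. D \<subseteq> A}. SUP E \<in> {D \<in> sets borel. D \<subseteq> B}. ennreal (\<nu> D) + ennreal (\<nu> E))"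
    by (simp only: p_def ennreal_SUP_add_right[OF ne])
  also have "\<dots> \<le> p (A \<union> B)"
    by (intro SUP_least) (auto intro: *)
  finally show ?thesis .
qed

lemma sets_positive_part [simp, measurable_cong]: "sets (positive_part \<nu>) = sets borel"
  unfolding positive_part_def using sets.sets_measure_of_eq[of borel] by simp

lemma space_positive_part [simp]: "space (positive_part \<nu>) = UNIV"
  unfolding positive_part_def by (simp add: space_measure_of_conv)

text \<open>\<open>measure_of\<close> returns the given set function only if that function is
  countably additive. Superadditivity on finite unions gives one inequality; for the other, a
  competitor \<open>B\<close> for the union is cut into the pieces
  \<open>B \<inter> A n\<close>.\<close>

lemma emeasure_positive_part:
  assumes nu: "signed_measure \<nu>" and E: "E \<in> sets borel"
  shows "emeasure (positive_part \<nu>) E = (SUP B \<in> {B \<in> sets borel. B \<subseteq> E}. ennreal (\<nu> B))"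
proof (rule emeasure_measure_of[OF positive_part_def])
  let ?p = "\<lambda>E. SUP B \<in> {B \<in> sets borel. B \<subseteq> E}. ennreal (\<nu> B)"
  show "sets borel \<subseteq> Pow UNIV" by simp
  show "E \<in> sets (positive_part \<nu>)"
    using E by simp
  have mono: "?p A \<le> ?p B" if "A \<subseteq> B" for A B
    using that by (intro SUP_subset_mono) auto
  have p0: "?p {} = 0"
  proof -
    have "{B \<in> sets borel. B \<subseteq> {}} = {{} :: 'a set}" by auto
    then show ?thesis by (simp add: signed_measure_empty[OF nu])
  qed
  then show "positive (sets (positive_part \<nu>)) ?p"
    by (simp add: positive_def)
  show "countably_additive (sets (positive_part \<nu>)) ?p"
    unfolding sets_positive_part
  proof (rule countably_additiveI)
    fix A :: "nat \<Rightarrow> 'a set"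
    assume A: "range A \<subseteq> sets borel" "disjoint_family A"
    have fin: "(\<Sum>i<n. ?p (A i)) \<le> ?p (\<Union>i<n. A i)" for n
    proof (induction n)
      case (Suc n)
      have "A i \<inter> A n = {}" if "i < n" for i
        using disjoint_family_onD[OF A(2), of i n] that by simp
      then have "(\<Union>i<n. A i) \<inter> A n = {}"
        by blast
      then have "?p (\<Union>i<n. A i) + ?p (A n) \<le> ?p ((\<Union>i<n. A i) \<union> A n)"
        by (rule positive_variation_superadditive[OF nu])
      moreover have "(\<Union>i<n. A i) \<union> A n = (\<Union>i<Suc n. A i)"
        by (auto simp: lessThan_Suc)
      ultimately have "?p (\<Union>i<n. A i) + ?p (A n) \<le> ?p (\<Union>i<Suc n. A i)"
        by (simp only:)
      then show ?case
        unfolding sum.lessThan_Suc by (rule order_trans[OF add_right_mono[OF Suc]])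
    qed simp
    have "(\<Sum>n. ?p (A n)) \<le> ?p (\<Union>n. A n)"
    proof (rule suminf_le_const[OF summableI])
      show "(\<Sum>i<n. ?p (A i)) \<le> ?p (\<Union>n. A n)" for n
        by (rule order_trans[OF fin mono]) blast
    qed
    moreover have "?p (\<Union>n. A n) \<le> (\<Sum>n. ?p (A n))"
    proof (rule SUP_least)
      fix B assume B: "B \<in> {B \<in> sets borel. B \<subseteq> (\<Union>n. A n)}"
      have "(\<lambda>n. \<nu> (B \<inter> A n)) sums \<nu> (\<Union>n. B \<inter> A n)"
        using A B by (intro nu[unfolded signed_measure_def, rule_format])
          (auto simp: disjoint_family_on_def)
      moreover have "(\<Union>n. B \<inter> A n) = B"
        using B by auto
      ultimately have "(\<lambda>n. \<Sum>i<n. \<nu> (B \<inter> A i)) \<longlonglongrightarrow> \<nu> B"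
        unfolding sums_def by (simp only:)
      then have "(\<lambda>n. ennreal (\<Sum>i<n. \<nu> (B \<inter> A i))) \<longlonglongrightarrow> ennreal (\<nu> B)"
        by (rule tendsto_ennrealI)
      moreover have "ennreal (\<Sum>i<n. \<nu> (B \<inter> A i)) \<le> (\<Sum>n. ?p (A n))" for n
      proof -
        have "ennreal (\<Sum>i<n. \<nu> (B \<inter> A i)) \<le> (\<Sum>i<n. ennreal (\<nu> (B \<inter> A i)))"
          by (rule sum_ennreal_ge)
        also have "\<dots> \<le> (\<Sum>i<n. ?p (A i))"
        proof (rule sum_mono)
          fix i
          have "B \<inter> A i \<in> {D \<in> sets borel. D \<subseteq> A i}"
            using A B by auto
          then show "ennreal (\<nu> (B \<inter> A i)) \<le> ?p (A i)"
            by (rule SUP_upper)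
        qed
        also have "\<dots> \<le> (\<Sum>n. ?p (A n))"
          by (intro sum_le_suminf summableI) auto
        finally show ?thesis .
      qed
      ultimately show "ennreal (\<nu> B) \<le> (\<Sum>n. ?p (A n))"
        by (rule LIMSEQ_le_const2[OF _ exI, OF _ allI, OF _ impI])
    qed
    ultimately show "(\<Sum>n. ?p (A n)) = ?p (\<Union>n. A n)"
      by (rule antisym)
  qed
qed

lemma emeasure_positive_part_le:
  assumes nu: "signed_measure \<nu>" and E: "E \<in> sets borel"
    and c: "\<And>B. B \<in> sets borel \<Longrightarrow> B \<subseteq> E \<Longrightarrow> \<bar>\<nu> B\<bar> \<le> c"
  shows "emeasure (positive_part \<nu>) E \<le> ennreal c"
  unfolding emeasure_positive_part[OF nu E]
  using c by (intro SUP_least ennreal_leI) (auto simp: abs_le_iff)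

lemma finite_measure_positive_part:
  assumes "signed_measure \<nu>"
  shows "finite_measure (positive_part \<nu>)"
proof (rule signed_measure_bounded[OF assms])
  fix C assume "\<And>B. B \<in> sets borel \<Longrightarrow> \<bar>\<nu> B\<bar> \<le> C"
  then have "emeasure (positive_part \<nu>) UNIV \<le> ennreal C"
    by (intro emeasure_positive_part_le assms) auto
  then show ?thesis
    by (intro finite_measureI) (auto simp: top_unique)
qed

lemma measure_positive_part_le:
  assumes nu: "signed_measure \<nu>" and E: "E \<in> sets borel"
    and c: "\<And>B. B \<in> sets borel \<Longrightarrow> B \<subseteq> E \<Longrightarrow> \<bar>\<nu> B\<bar> \<le> c"
  shows "measure (positive_part \<nu>) E \<le> c"
proof -
  have "0 \<le> c" using c[of "{}"] by auto
  then show ?thesis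
    using emeasure_positive_part_le[OF assms] by (simp add: measure_def enn2real_leI)
qed

section \<open>Total variation and tightness of regular measures\<close>

lemma signed_measure_sum_abs_le:
  assumes nu: "signed_measure \<nu>" and C: "\<And>B. B \<in> sets borel \<Longrightarrow> \<bar>\<nu> B\<bar> \<le> C"
    and A: "range A \<subseteq> sets borel" "disjoint_family (A :: nat \<Rightarrow> _)"
  shows "(\<Sum>i<n. \<bar>\<nu> (A i)\<bar>) \<le> 2 * C"
proof -
  \<comment> \<open>Over indices of one sign the absolute values add up to the absolute measure of a
    single union, which is at most \<open>C\<close>.\<close>
  let ?P = "{i\<in>{..<n}. \<nu> (A i) \<ge> 0}" and ?N = "{i\<in>{..<n}. \<not> \<nu> (A i) \<ge> 0}"
  have "(\<Sum>i<n. \<bar>\<nu> (A i)\<bar>) = (\<Sum>i\<in>?P. \<bar>\<nu> (A i)\<bar>) + (\<Sum>i\<in>?N. \<bar>\<nu> (A i)\<bar>)"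
    by (subst sum.union_disjoint[symmetric]) (auto intro!: sum.cong)
  also have "\<dots> = (\<Sum>i\<in>?P. \<nu> (A i)) - (\<Sum>i\<in>?N. \<nu> (A i))"
    by (simp add: sum_negf flip: diff_minus_eq_add)
  also have "\<dots> = \<nu> (\<Union>i\<in>?P. A i) - \<nu> (\<Union>i\<in>?N. A i)"
    using A by (subst (1 2) signed_measure_UN_finite[OF nu])
      (auto intro: disjoint_family_on_mono[OF subset_UNIV])
  also have "\<dots> \<le> C + C"
  proof -
    have "\<bar>\<nu> (\<Union>i\<in>?P. A i)\<bar> \<le> C" "\<bar>\<nu> (\<Union>i\<in>?N. A i)\<bar> \<le> C"
      using A by (auto intro!: C)
    then show ?thesis by linarith
  qed
  finally show ?thesis by simp
qed

lemma complex_borel_measure_bounded: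
  assumes "complex_borel_measure \<mu>"
  obtains C where "\<And>B. B \<in> sets borel \<Longrightarrow> norm (\<mu> B) \<le> C"
proof -
  obtain C1 C2 where C: "\<And>B. B \<in> sets borel \<Longrightarrow> \<bar>Re (\<mu> B)\<bar> \<le> C1" "\<And>B. B \<in> sets borel \<Longrightarrow> \<bar>Im (\<mu> B)\<bar> \<le> C2"
    using signed_measure_bounded complex_borel_measure_Re_Im[OF assms] by metis
  have "norm (\<mu> B) \<le> C1 + C2" if "B \<in> sets borel" for B
    using C[OF that] cmod_le[of "\<mu> B"] by linarith
  then show ?thesis by (rule that)
qed

text \<open>The modulus is at most the sum of the absolute values of real and imaginary part, and
  each of these is summable along disjoint sets with a common bound. Finiteness is what permits
  cancelling \<open>total_variation \<mu> K\<close> in the proof of tightness.\<close>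

lemma total_variation_finite:
  assumes mu: "complex_borel_measure \<mu>"
  shows "total_variation \<mu> E < top"
proof -
  obtain C1 C2 where C: "\<And>B. B \<in> sets borel \<Longrightarrow> \<bar>Re (\<mu> B)\<bar> \<le> C1" "\<And>B. B \<in> sets borel \<Longrightarrow> \<bar>Im (\<mu> B)\<bar> \<le> C2"
    using signed_measure_bounded complex_borel_measure_Re_Im[OF mu] by metis
  have "total_variation \<mu> E \<le> ennreal (2 * C1 + 2 * C2)"
    unfolding total_variation_def
  proof (intro SUP_least suminf_le_const summableI)
    fix A n
    assume "A \<in> {A :: nat \<Rightarrow> 'a set. range A \<subseteq> sets borel \<and> disjoint_family A \<and> (\<Union>n. A n) = E}"
    then have A: "range A \<subseteq> sets borel" "disjoint_family A"
      by auto
    have "(\<Sum>i<n. norm (\<mu> (A i))) \<le> (\<Sum>i<n. \<bar>Re (\<mu> (A i))\<bar> + \<bar>Im (\<mu> (A i))\<bar>)"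
      by (intro sum_mono cmod_le)
    also have "\<dots> \<le> 2 * C1 + 2 * C2"
      unfolding sum.distrib using signed_measure_sum_abs_le complex_borel_measure_Re_Im[OF mu] C A
      by (intro add_mono) blast+
    finally show "(\<Sum>i<n. ennreal (norm (\<mu> (A i)))) \<le> ennreal (2 * C1 + 2 * C2)"
      by (simp add: sum_ennreal ennreal_leI)
  qed
  then show ?thesis
    by (simp add: le_less_trans)
qed

text \<open>A partition of \<open>K\<close> becomes one of the whole space when \<open>B\<close> and
  the complement of \<open>B \<union> K\<close> are put in front. This inequality does the work of
  additivity of the total variation.\<close>

lemma norm_add_total_variation_le:
  assumes B: "B \<in> sets borel" "B \<inter> K = {}" and K: "K \<in> sets borel"
  shows "ennreal (norm (\<mu> B)) + total_variation \<mu> K \<le> total_variation \<mu> UNIV"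
proof -
  let ?P = "{A :: nat \<Rightarrow> 'a set. range A \<subseteq> sets borel \<and> disjoint_family A \<and> (\<Union>n. A n) = K}"
  \<comment> \<open>A constant can be moved into a supremum in \<open>ennreal\<close> only if the
    index set is nonempty; here \<open>K\<close> followed by empty sets is a partition.\<close>
  have ne: "?P \<noteq> {}"
  proof -
    have "binaryset K {} \<in> ?P"
      using K by (auto simp: range_binaryset_eq disjoint_family_on_def UN_binaryset_eq) (auto simp: binaryset_def split: if_splits)
    then show ?thesis by blast
  qed
  have "ennreal (norm (\<mu> B)) + (\<Sum>n. ennreal (norm (\<mu> (A n)))) \<le> total_variation \<mu> UNIV"
    if "A \<in> ?P" for A
  proof -
    define A' where "A' n = (case n of 0 \<Rightarrow> B | Suc 0 \<Rightarrow> - B - K | Suc (Suc m) \<Rightarrow> A m)" for n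
    have A'_simps: "A' 0 = B" "A' (Suc 0) = - B - K" "A' (Suc (Suc m)) = A m" for m
      by (auto simp: A'_def)
    have sub: "A m \<subseteq> K" for m
      using that by auto
    have Abor: "A m \<in> sets borel" for m
      using that by auto
    have disj: "A i \<inter> A j = {}" if "i \<noteq> j" for i j
      using \<open>A \<in> ?P\<close> that by (auto simp: disjoint_family_on_def)
    have split: "n = 0 \<or> n = Suc 0 \<or> (\<exists>m. n = Suc (Suc m))" for n
      by (metis not0_implies_Suc)
    have "A' n \<in> sets borel" for n
      using split[of n] B K Abor by (auto simp: A'_simps Compl_eq_Diff_UNIV)
    moreover have "A' i \<inter> A' j = {}" if "i \<noteq> j" for i j
    proof -
      have "B \<inter> A m = {}" "A m \<inter> B = {}" "(- B - K) \<inter> A m = {}" "A m \<inter> (- B - K) = {}" for m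
        using sub[of m] B(2) by auto
      then show ?thesis
        using split[of i] split[of j] that disj
        by (elim disjE exE) (simp_all add: A'_simps, blast+)
    qed
    moreover have "(\<Union>n. A' n) = UNIV"
    proof -
      have "x \<in> (\<Union>n. A' n)" for x
      proof -
        consider "x \<in> B" | "x \<in> - B - K" | "x \<in> K" by auto
        then show ?thesis
        proof cases
          case 1 then show ?thesis by (metis A'_simps(1) UN_I UNIV_I)
        next
          case 2 then show ?thesis by (metis A'_simps(2) UN_I UNIV_I)
        next
          case 3
          moreover have "(\<Union>n. A n) = K" using that by simp
          ultimately obtain m where "x \<in> A m" by blast
          then show ?thesis by (metis A'_simps(3) UN_I UNIV_I)
        qed
      qed
      then show ?thesis by auto
    qed
    ultimately have "(\<Sum>n. ennreal (norm (\<mu> (A' n)))) \<le> total_variation \<mu> UNIV"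
      unfolding total_variation_def by (intro SUP_upper) (auto simp: disjoint_family_on_def)
    moreover have "(\<Sum>n. ennreal (norm (\<mu> (A' n)))) =
        (\<Sum>n. ennreal (norm (\<mu> (A n)))) + (ennreal (norm (\<mu> B)) + ennreal (norm (\<mu> (- B - K))))"
      using suminf_offset[of "\<lambda>n. ennreal (norm (\<mu> (A' n)))" "Suc (Suc 0)", OF summableI]
      by (simp add: A'_simps)
    moreover have "ennreal (norm (\<mu> B)) + (\<Sum>n. ennreal (norm (\<mu> (A n)))) \<le> \<dots>"
    proof -
      have "x + y \<le> y + (x + z)" for x y z :: ennreal
      proof -
        have "y + (x + z) = (x + y) + z"
          by (simp only: ac_simps)
        then show ?thesis by simp
      qed
      then show ?thesis .
    qed
    ultimately show ?thesis
      by (simp only:)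
  qed
  then show ?thesis
    unfolding total_variation_def[of \<mu> K] ennreal_SUP_add_right[OF ne]
    by (intro SUP_least)
qed

text \<open>Inner regularity of the whole space yields a compact \<open>K\<close> that carries all
  but \<open>\<epsilon>\<close> of the total variation. A set disjoint from \<open>K\<close> has to
  share what is left.\<close>

lemma regular_measure_tight:
  fixes \<mu> :: "'g::t2_space set \<Rightarrow> complex"
  assumes mu: "complex_borel_measure \<mu>" "regular_measure \<mu>" and "0 < \<epsilon>"
  obtains K where "compact K" "\<And>B. B \<in> sets borel \<Longrightarrow> B \<inter> K = {} \<Longrightarrow> norm (\<mu> B) \<le> \<epsilon>"
proof -
  have "total_variation \<mu> UNIV = (SUP K \<in> {K. compact K \<and> K \<subseteq> UNIV}. total_variation \<mu> K)"
    by (rule conjunct2[OF bspec[OF mu(2)[unfolded regular_measure_def]]]) simp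
  moreover have "total_variation \<mu> UNIV \<noteq> \<infinity>"
    using total_variation_finite[OF mu(1)] by (simp add: less_top)
  ultimately have "\<exists>K\<in>{K. compact K \<and> K \<subseteq> UNIV}. total_variation \<mu> UNIV < total_variation \<mu> K + ennreal \<epsilon>"
    using \<open>0 < \<epsilon>\<close> by (intro SUP_approx_ennreal) auto
  then obtain K where K: "compact K" "total_variation \<mu> UNIV < total_variation \<mu> K + ennreal \<epsilon>"
    by blast
  show ?thesis
  proof (rule that[OF K(1)])
    fix B :: "'g set" assume B: "B \<in> sets borel" "B \<inter> K = {}"
    have "ennreal (norm (\<mu> B)) + total_variation \<mu> K \<le> ennreal \<epsilon> + total_variation \<mu> K"
    proof -
      have "ennreal (norm (\<mu> B)) + total_variation \<mu> K \<le> total_variation \<mu> UNIV"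
        using K(1) by (intro norm_add_total_variation_le B) (simp add: borel_closed compact_imp_closed)
      also have "\<dots> \<le> ennreal \<epsilon> + total_variation \<mu> K"
        using K(2) by (simp add: add.commute)
      finally show ?thesis .
    qed
    moreover have "total_variation \<mu> K \<noteq> top"
      using total_variation_finite[OF mu(1)] by (simp add: less_top)
    ultimately show "norm (\<mu> B) \<le> \<epsilon>"
      using \<open>0 < \<epsilon>\<close> by (simp add: ennreal_add_left_cancel_le add.commute)
  qed
qed

subsection \<open>LUC and its dual\<close>

lemma g_space_plus:
  assumes "locally_compact_space (euclidean :: 'g::{topological_group_add,t2_space} topology)"
  shows "g_space ((+) :: 'g \<Rightarrow> 'g \<Rightarrow> 'g)"
  using assms by (auto simp: g_space_def case_prod_beta add.assoc intro!: continuous_intros)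

lemma translate_add:
  "g_space act \<Longrightarrow> translate act s (F + H) = translate act s F + translate act s H"
  by (rule bcontfun_eqI) (simp add: apply_translate)

lemma translate_diff:
  "g_space act \<Longrightarrow> translate act s (F - H) = translate act s F - translate act s H"
  by (rule bcontfun_eqI) (simp add: apply_translate)

lemma translate_cscale:
  "g_space act \<Longrightarrow> translate act s (cscale c F) = cscale c (translate act s F)"
  by (rule bcontfun_eqI) (simp add: apply_translate)

lemma norm_cscale_le: "norm (cscale c F) \<le> norm c * norm F"
  by (rule norm_bound) (simp add: norm_mult mult_left_mono norm_bounded)

lemma cscale_diff: "cscale c (F - H) = cscale c F - cscale c H"
  by (rule bcontfun_eqI) (simp add: algebra_simps)

lemma continuous_on_cscale:
  assumes "continuous_on S f"
  shows "continuous_on S (\<lambda>s. cscale c (f s))"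
proof (rule continuous_on_compose2[OF _ assms subset_UNIV])
  have "(norm c)-lipschitz_on UNIV (cscale c)"
    by (rule lipschitz_onI) (simp_all add: dist_norm norm_cscale_le flip: cscale_diff)
  then show "continuous_on UNIV (cscale c)"
    by (rule lipschitz_on_continuous_on)
qed

lemma LUC_zero: "g_space act \<Longrightarrow> 0 \<in> LUC act"
  using translate_diff[of act _ 0 0] by (simp add: LUC_def)

lemma LUC_add: "g_space act \<Longrightarrow> F \<in> LUC act \<Longrightarrow> H \<in> LUC act \<Longrightarrow> F + H \<in> LUC act"
  by (auto simp: LUC_def translate_add intro: continuous_intros)

lemma LUC_cscale: "g_space act \<Longrightarrow> F \<in> LUC act \<Longrightarrow> cscale c F \<in> LUC act"
  by (simp add: LUC_def translate_cscale continuous_on_cscale)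

text \<open>Translations do not increase the norm, so the orbit maps of the \<open>f n\<close>
  converge uniformly on the group, and uniform limits preserve continuity.\<close>

lemma LUC_tendsto:
  assumes G: "g_space act" and f: "\<And>n. f n \<in> LUC act" "f \<longlonglongrightarrow> F"
  shows "F \<in> LUC act"
proof -
  have "uniform_limit UNIV (\<lambda>n s. translate act s (f n)) (\<lambda>s. translate act s F) sequentially"
  proof (rule uniform_limitI)
    fix e :: real assume "0 < e"
    with f(2) have "\<forall>\<^sub>F n in sequentially. dist (f n) F < e"
      by (rule tendstoD)
    then show "\<forall>\<^sub>F n in sequentially. \<forall>s\<in>UNIV. dist (translate act s (f n)) (translate act s F) < e"
      by eventually_elim
        (auto simp: dist_norm simp flip: translate_diff[OF G] intro: le_less_trans[OF norm_translate_le[OF G]])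
  qed
  moreover have "\<forall>\<^sub>F n in sequentially. continuous_on UNIV (\<lambda>s. translate act s (f n))"
    using f(1) by (simp add: LUC_def)
  ultimately show ?thesis
    unfolding LUC_def by (simp add: uniform_limit_theorem)
qed

lemma dual_add: "M \<in> dual L \<Longrightarrow> F \<in> L \<Longrightarrow> H \<in> L \<Longrightarrow> M (F + H) = M F + M H"
  by (simp add: dual_def)

lemma dual_cscale: "M \<in> dual L \<Longrightarrow> F \<in> L \<Longrightarrow> M (cscale c F) = c * M F"
  by (simp add: dual_def)

lemma dual_zero: "M \<in> dual (LUC act) \<Longrightarrow> g_space act \<Longrightarrow> M 0 = 0"
  using dual_add[of M "LUC act" 0 0] LUC_zero[of act] by simp

lemma dual_diff:
  assumes "g_space act" "M \<in> dual (LUC act)" "F \<in> LUC act" "H \<in> LUC act"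
  shows "M (F - H) = M F - M H"
  using dual_add[OF assms(2) diff_in_LUC[OF assms(1,3,4)] assms(4)] by simp

lemma dual_bound:
  assumes "M \<in> dual L"
  obtains B where "0 \<le> B" "\<And>F. F \<in> L \<Longrightarrow> norm (M F) \<le> B * norm F"
proof -
  obtain B where B: "\<forall>F\<in>L. norm (M F) \<le> B * norm F"
    using assms by (auto simp: dual_def)
  have "norm (M F) \<le> \<bar>B\<bar> * norm F" if "F \<in> L" for F
    using B that by (meson abs_ge_self mult_right_mono norm_ge_zero order_trans)
  with that[of "\<bar>B\<bar>"] show ?thesis by simp
qed

lemma dualI:
  assumes "M \<in> extensional L" "\<And>F H. F \<in> L \<Longrightarrow> H \<in> L \<Longrightarrow> M (F + H) = M F + M H"
    "\<And>c F. F \<in> L \<Longrightarrow> M (cscale c F) = c * M F" "\<And>F. F \<in> L \<Longrightarrow> norm (M F) \<le> B * norm F"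
  shows "M \<in> dual L"
  using assms unfolding dual_def by blast

text \<open>Point evaluations have bound 1. An estimate valid for all functionals with a given bound
  therefore yields one in the supremum norm.\<close>

lemma evaluation_dual:
  assumes "g_space act"
  shows "restrict (\<lambda>F. apply_bcontfun F x) (LUC act) \<in> dual (LUC act)"
  by (rule dualI[where B = 1]) (auto simp: LUC_add LUC_cscale assms norm_bounded)

section \<open>The functions MF and the module action\<close>

lemma orbit_fun_add:
  assumes "g_space act" "M \<in> dual (LUC act)" "F \<in> LUC act" "H \<in> LUC act"
  shows "orbit_fun act M (F + H) = orbit_fun act M F + orbit_fun act M H"
  using assms by (intro bcontfun_eqI) (simp add: apply_orbit_fun translate_add dual_add translate_in_LUC LUC_add)

lemma orbit_fun_diff:
  assumes "g_space act" "M \<in> dual (LUC act)" "F \<in> LUC act" "H \<in> LUC act"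
  shows "orbit_fun act M (F - H) = orbit_fun act M F - orbit_fun act M H"
  using assms by (intro bcontfun_eqI) (simp add: apply_orbit_fun translate_diff dual_diff translate_in_LUC diff_in_LUC)

lemma orbit_fun_cscale:
  assumes "g_space act" "M \<in> dual (LUC act)" "F \<in> LUC act"
  shows "orbit_fun act M (cscale c F) = cscale c (orbit_fun act M F)"
  using assms by (intro bcontfun_eqI) (simp add: apply_orbit_fun translate_cscale dual_cscale translate_in_LUC LUC_cscale)

lemma norm_orbit_fun_le:
  assumes G: "g_space act" and M: "M \<in> dual (LUC act)" and F: "F \<in> LUC act"
    and B: "0 \<le> B" "\<And>F. F \<in> LUC act \<Longrightarrow> norm (M F) \<le> B * norm F"
  shows "norm (orbit_fun act M F) \<le> B * norm F"
proof (rule norm_bound)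
  fix s
  have "norm (M (translate act s F)) \<le> B * norm (translate act s F)"
    by (rule B(2)) (rule translate_in_LUC[OF G F])
  also have "\<dots> \<le> B * norm F"
    by (intro mult_left_mono norm_translate_le G B)
  finally show "norm (apply_bcontfun (orbit_fun act M F) s) \<le> B * norm F"
    by (simp add: apply_orbit_fun[OF G M F])
qed

text \<open>Translating MF by \<open>t\<close> amounts to replacing F by its translate. Since F
  \<mapsto> MF is Lipschitz, the norm continuity of the orbit map of F carries over to MF.\<close>

lemma orbit_fun_in_LUC:
  fixes act :: "'g::{topological_group_add,t2_space} \<Rightarrow> 'x::t2_space \<Rightarrow> 'x"
  assumes lc: "locally_compact_space (euclidean :: 'g topology)"
    and G: "g_space act" and M: "M \<in> dual (LUC act)" and F: "F \<in> LUC act"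
  shows "orbit_fun act M F \<in> LUC (+)"
proof -
  obtain B where B: "0 \<le> B" "\<And>F. F \<in> LUC act \<Longrightarrow> norm (M F) \<le> B * norm F"
    using dual_bound[OF M] by blast
  have "translate (+) t (orbit_fun act M F) = orbit_fun act M (translate act t F)" for t
    by (rule bcontfun_eqI)
      (simp add: apply_translate g_space_plus lc apply_orbit_fun G M F translate_in_LUC translate_translate)
  moreover have "continuous_on UNIV (\<lambda>t. orbit_fun act M (translate act t F))"
  proof (rule continuous_on_compose2[where g = "orbit_fun act M"])
    have "B-lipschitz_on (LUC act) (orbit_fun act M)"
      using B norm_orbit_fun_le[OF G M _ B] diff_in_LUC[OF G]
      by (intro lipschitz_onI) (simp_all add: dist_norm flip: orbit_fun_diff[OF G M])
    then show "continuous_on (LUC act) (orbit_fun act M)"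
      by (rule lipschitz_on_continuous_on)
    show "continuous_on UNIV (\<lambda>t. translate act t F)"
      using F by (simp add: LUC_def)
  qed (auto intro: translate_in_LUC[OF G F])
  ultimately show ?thesis
    by (simp add: LUC_def)
qed

text \<open>\<open>weak_star\<close> is a subtopology, so continuity into it includes the claim that
  the values lie in the dual.\<close>

lemma module_act_in_dual:
  fixes act :: "'g::{topological_group_add,t2_space} \<Rightarrow> 'x::t2_space \<Rightarrow> 'x"
  assumes lc: "locally_compact_space (euclidean :: 'g topology)"
    and G: "g_space act" and m: "m \<in> dual (LUC (+))" and M: "M \<in> dual (LUC act)"
  shows "module_act act m M \<in> dual (LUC act)"
proof -
  obtain B where B: "0 \<le> B" "\<And>F. F \<in> LUC act \<Longrightarrow> norm (M F) \<le> B * norm F"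
    using dual_bound[OF M] by blast
  obtain b where b: "0 \<le> b" "\<And>F. F \<in> LUC (+) \<Longrightarrow> norm (m F) \<le> b * norm F"
    using dual_bound[OF m] by blast
  note luc = orbit_fun_in_LUC[OF lc G M]
  show ?thesis
  proof (rule dualI)
    show "module_act act m M \<in> extensional (LUC act)"
      by (simp add: module_act_def)
    show "norm (module_act act m M F) \<le> (b * B) * norm F" if F: "F \<in> LUC act" for F
    proof -
      have "norm (m (orbit_fun act M F)) \<le> b * norm (orbit_fun act M F)"
        by (rule b(2)[OF luc[OF F]])
      also have "\<dots> \<le> b * (B * norm F)"
        by (intro mult_left_mono norm_orbit_fun_le G M F B b)
      finally show ?thesis
        using F by (simp add: module_act_def mult.assoc)
    qed
  qed (simp_all add: module_act_def LUC_add LUC_cscale G M orbit_fun_add orbit_fun_cscale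
      dual_add[OF m] dual_cscale[OF m] luc)
qed

text \<open>A weak* continuous linear functional on the dual is evaluation at a point, so this
  sufficient condition is also necessary.\<close>

lemma top_centreI:
  fixes act :: "'g::{topological_group_add,t2_space} \<Rightarrow> 'x::t2_space \<Rightarrow> 'x"
  assumes lc: "locally_compact_space (euclidean :: 'g topology)"
    and G: "g_space act" and m: "m \<in> dual (LUC (+))"
    and repr: "\<And>F. F \<in> LUC act \<Longrightarrow>
      \<exists>H\<in>LUC act. \<forall>M\<in>dual (LUC act). m (orbit_fun act M F) = M H"
  shows "m \<in> top_centre act"
proof -
  let ?P = "product_topology (\<lambda>_. euclidean) (LUC act) :: (('x \<Rightarrow>\<^sub>C complex) \<Rightarrow> complex) topology"
  have top: "topspace (weak_star (LUC act)) = dual (LUC act)"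
    by (auto simp: weak_star_def dual_def PiE_def)
  have "continuous_map (weak_star (LUC act)) ?P (module_act act m)"
    unfolding continuous_map_componentwise
  proof (intro conjI ballI image_subsetI)
    fix F assume F: "F \<in> LUC act"
    then obtain H where H: "H \<in> LUC act" "\<forall>M\<in>dual (LUC act). m (orbit_fun act M F) = M H"
      using repr by blast
    \<comment> \<open>On the dual, coordinate \<open>F\<close> of the module action is evaluation at
      \<open>H\<close>, a coordinate projection of the product.\<close>
    have "continuous_map (weak_star (LUC act)) euclidean (\<lambda>M. M H)"
      unfolding weak_star_def
      by (intro continuous_map_from_subtopology continuous_map_product_projection H(1))
    then show "continuous_map (weak_star (LUC act)) euclidean (\<lambda>M. module_act act m M F)"
      by (rule continuous_map_eq) (simp add: top module_act_def F H(2))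
  qed (simp add: module_act_def)
  then have "continuous_map (weak_star (LUC act)) (weak_star (LUC act)) (module_act act m)"
    unfolding weak_star_def[of "LUC act"] continuous_map_in_subtopology
    using module_act_in_dual[OF lc G m] by (auto simp: top simp flip: weak_star_def)
  with m show ?thesis
    by (simp add: top_centre_def)
qed

subsection \<open>Measures act weak* continuously\<close>

lemma integrable_bcontfun:
  fixes f :: "'g::t2_space \<Rightarrow>\<^sub>C complex"
  assumes "finite_measure p" and [measurable_cong, simp]: "sets p = sets borel"
  shows "integrable p (apply_bcontfun f)"
proof -
  interpret finite_measure p by fact
  have "apply_bcontfun f \<in> borel_measurable borel"
    by (rule borel_measurable_continuous_onI) simp
  then have "apply_bcontfun f \<in> borel_measurable p"
    by (simp cong: measurable_cong_sets)
  then show ?thesis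
    by (rule integrable_const_bound[rotated]) (auto intro: norm_bounded)
qed

lemma norm_set_integral_le:
  fixes g :: "'g \<Rightarrow> complex"
  assumes "finite_measure p" and A: "A \<in> sets p" and g: "integrable p g"
    and c: "\<And>s. s \<in> A \<Longrightarrow> norm (g s) \<le> c"
  shows "norm (LINT s:A|p. g s) \<le> c * measure p A"
proof -
  interpret finite_measure p by fact
  have "integrable p (indicator A :: _ \<Rightarrow> real)"
    using A by (intro integrable_real_indicator) (auto simp: less_top[symmetric])
  then have "norm (LINT s:A|p. g s) \<le> (LINT s|p. c * indicator A s)"
    unfolding set_lebesgue_integral_def
    using A g c by (intro order_trans[OF integral_norm_bound integral_mono] integrable_norm
        integrable_mult_indicator) (auto split: split_indicator)
  also have "\<dots> = c * measure p A"
    using A by simp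
  finally show ?thesis .
qed

text \<open>Induction on the sample points: on the part of \<open>A\<close> near \<open>t\<close>
  the integrand differs from \<open>M (translate act t F)\<close> by at most \<open>B * e\<close>,
  so the translate by \<open>t\<close> enters with the measure of that part as its weight. The rest
  of \<open>A\<close> is left to the remaining points. One \<open>h\<close> has to serve all
  \<open>M\<close> at once, since it will approximate a single element of
  \<open>LUC act\<close>.\<close>

lemma riemann_sum_on_cover:
  assumes G: "g_space act" and F: "F \<in> LUC act"
    and p: "finite_measure p" "sets p = sets borel"
    and T: "finite T" and A: "A \<in> sets borel"
      "A \<subseteq> (\<Union>t\<in>T. {s. norm (translate act s F - translate act t F) < e})"
  shows "\<exists>h\<in>LUC act. \<forall>M\<in>dual (LUC act). \<forall>B\<ge>0. (\<forall>F\<in>LUC act. norm (M F) \<le> B * norm F) \<longrightarrow>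
    norm (M h - (LINT s:A|p. apply_bcontfun (orbit_fun act M F) s)) \<le> B * e * measure p A"
  using T A
proof (induction T arbitrary: A)
  case empty
  then show ?case
    by (intro bexI[of _ 0]) (auto simp: dual_zero G LUC_zero set_lebesgue_integral_def)
next
  case (insert t T)
  interpret finite_measure p by fact
  let ?U = "{s. norm (translate act s F - translate act t F) < e}"
  have "open ?U"
    using F by (intro open_Collect_less continuous_intros) (simp add: LUC_def)
  then have bor: "A \<inter> ?U \<in> sets borel" "A - ?U \<in> sets borel"
    using insert.prems(1) by auto
  moreover have "A - ?U \<subseteq> (\<Union>t\<in>T. {s. norm (translate act s F - translate act t F) < e})"
    using insert.prems(2) by auto
  ultimately obtain h where h: "h \<in> LUC act"
    "\<And>M B. M \<in> dual (LUC act) \<Longrightarrow> B \<ge> 0 \<Longrightarrow> (\<forall>F\<in>LUC act. norm (M F) \<le> B * norm F) \<Longrightarrow>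
      norm (M h - (LINT s:A - ?U|p. apply_bcontfun (orbit_fun act M F) s)) \<le> B * e * measure p (A - ?U)"
    using insert.IH by meson
  let ?c = "complex_of_real (measure p (A \<inter> ?U))"
  let ?k = "cscale ?c (translate act t F)"
  have k: "?k \<in> LUC act"
    by (intro LUC_cscale G translate_in_LUC F)
  show ?case
  proof (intro bexI[of _ "?k + h"] ballI allI impI)
    fix M B
    assume M: "M \<in> dual (LUC act)" and B: "B \<ge> 0" "\<forall>F\<in>LUC act. norm (M F) \<le> B * norm F"
    let ?g = "apply_bcontfun (orbit_fun act M F)" and ?m = "M (translate act t F)"
    have int: "integrable p ?g"
      by (rule integrable_bcontfun[OF p])
    have sint: "set_integrable p C ?g" if "C \<in> sets borel" for C
      using that int p(2) unfolding set_integrable_def by (intro integrable_mult_indicator) auto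
    have "?g s - ?m = M (translate act s F - translate act t F)" for s
      by (simp add: apply_orbit_fun[OF G M F] dual_diff[OF G M] translate_in_LUC[OF G F])
    then have "norm (?g s - ?m) \<le> B * e" if "s \<in> A \<inter> ?U" for s
      using that B diff_in_LUC[OF G translate_in_LUC[OF G F] translate_in_LUC[OF G F]]
      by (auto intro: order_trans[OF _ mult_left_mono[OF less_imp_le]])
    then have near: "norm (LINT s:A \<inter> ?U|p. ?g s - ?m) \<le> B * e * measure p (A \<inter> ?U)"
      using bor p int by (intro norm_set_integral_le) auto
    have "(LINT s:A \<inter> ?U|p. ?g s - ?m) = (LINT s:A \<inter> ?U|p. ?g s) - ?c * ?m"
    proof -
      have "(LINT s:A \<inter> ?U|p. ?m) = ?c * ?m"
        using bor(1) p(2) unfolding set_lebesgue_integral_def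
        by (simp add: scaleR_conv_of_real)
      moreover have "set_integrable p (A \<inter> ?U) (\<lambda>_. ?m)"
        using bor(1) p(2) unfolding set_integrable_def by (intro integrable_mult_indicator) auto
      ultimately show ?thesis
        using bor by (simp add: set_integral_diff(2) sint)
    qed
    moreover have "(LINT s:A|p. ?g s) = (LINT s:A \<inter> ?U|p. ?g s) + (LINT s:A - ?U|p. ?g s)"
    proof -
      have "A = (A \<inter> ?U) \<union> (A - ?U)" by auto
      then show ?thesis
        using set_integral_Un[of "A \<inter> ?U" "A - ?U" p ?g] sint bor by auto
    qed
    moreover have "M (?k + h) = ?c * ?m + M h"
      by (simp add: dual_add[OF M k h(1)] dual_cscale[OF M translate_in_LUC[OF G F]])
    ultimately have "M (?k + h) - (LINT s:A|p. ?g s) =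
        - (LINT s:A \<inter> ?U|p. ?g s - ?m) + (M h - (LINT s:A - ?U|p. ?g s))"
      by simp
    then have "norm (M (?k + h) - (LINT s:A|p. ?g s)) =
        norm (- (LINT s:A \<inter> ?U|p. ?g s - ?m) + (M h - (LINT s:A - ?U|p. ?g s)))"
      by (simp only:)
    also have "\<dots> \<le> norm (- (LINT s:A \<inter> ?U|p. ?g s - ?m)) + norm (M h - (LINT s:A - ?U|p. ?g s))"
      by (rule norm_triangle_ineq)
    also have "\<dots> \<le> B * e * measure p (A \<inter> ?U) + B * e * measure p (A - ?U)"
      unfolding norm_minus_cancel by (rule add_mono[OF near h(2)[OF M B]])
    also have "\<dots> = B * e * measure p A"
    proof -
      have "measure p A = measure p (A \<inter> ?U) + measure p (A - ?U)"
      proof -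
        have "measure p (A \<inter> ?U \<union> (A - ?U)) = measure p (A \<inter> ?U) + measure p (A - ?U)"
          using bor p(2) by (intro finite_measure_Union) auto
        then show ?thesis by (simp add: Int_Diff_Un)
      qed
      then show ?thesis by (simp add: distrib_left)
    qed
    finally show "norm (M (?k + h) - (LINT s:A|p. ?g s)) \<le> B * e * measure p A" .
  qed (intro LUC_add G k h)
qed

text \<open>A compact \<open>K\<close> carries all but \<open>e\<close> of the mass and is covered
  by finitely many sets on which the translates of F stay within \<open>e\<close> of a sample. Off
  \<open>K\<close> the integrand is at most \<open>B * norm F\<close>.\<close>

lemma riemann_sum:
  fixes act :: "'g::{topological_group_add,t2_space} \<Rightarrow> 'x::t2_space \<Rightarrow> 'x"
  assumes G: "g_space act" and F: "F \<in> LUC act"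
    and p: "finite_measure p" "sets p = sets borel"
    and tight: "\<And>e. 0 < e \<Longrightarrow> \<exists>K. compact K \<and> measure p (- K) \<le> e" and "0 < \<epsilon>"
  shows "\<exists>h\<in>LUC act. \<forall>M\<in>dual (LUC act). \<forall>B\<ge>0. (\<forall>F\<in>LUC act. norm (M F) \<le> B * norm F) \<longrightarrow>
    norm (M h - (LINT s|p. apply_bcontfun (orbit_fun act M F) s)) \<le> B * \<epsilon>"
proof -
  interpret finite_measure p by fact
  \<comment> \<open>Up to the factor \<open>B\<close>, the error is
    \<open>e * measure p UNIV\<close> on \<open>K\<close> and \<open>norm F * e\<close> off
    \<open>K\<close>. The summand 1 keeps the denominator positive.\<close>
  define e where "e = \<epsilon> / (measure p UNIV + norm F + 1)"
  have pos: "measure p UNIV + norm F + 1 > 0"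
    by (simp add: add_nonneg_pos)
  have e: "0 < e" "e * measure p UNIV + norm F * e \<le> \<epsilon>"
  proof -
    show "0 < e" using pos \<open>0 < \<epsilon>\<close> by (simp add: e_def)
    then have "e * measure p UNIV + norm F * e \<le> e * (measure p UNIV + norm F + 1)"
      by (simp add: algebra_simps)
    also have "\<dots> = \<epsilon>"
      using pos by (simp add: e_def)
    finally show "e * measure p UNIV + norm F * e \<le> \<epsilon>" .
  qed
  obtain K where K: "compact K" "measure p (- K) \<le> e"
    using tight[OF e(1)] by blast
  then have Kb: "K \<in> sets borel" "- K \<in> sets borel"
    by (auto simp: borel_closed compact_imp_closed)
  let ?U = "\<lambda>t. {s. norm (translate act s F - translate act t F) < e}"
  have "open (?U t)" for t
    using F by (intro open_Collect_less continuous_intros) (simp add: LUC_def)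
  moreover have "K \<subseteq> (\<Union>t\<in>UNIV. ?U t)"
  proof
    fix s show "s \<in> (\<Union>t\<in>UNIV. ?U t)"
      using e(1) by (intro UN_I[of s]) auto
  qed
  ultimately obtain T where T: "finite T" "K \<subseteq> (\<Union>t\<in>T. ?U t)"
    using compactE_image[OF K(1), of UNIV ?U] by metis
  then obtain h where h: "h \<in> LUC act"
    "\<And>M B. M \<in> dual (LUC act) \<Longrightarrow> B \<ge> 0 \<Longrightarrow> (\<forall>F\<in>LUC act. norm (M F) \<le> B * norm F) \<Longrightarrow>
      norm (M h - (LINT s:K|p. apply_bcontfun (orbit_fun act M F) s)) \<le> B * e * measure p K"
    using riemann_sum_on_cover[OF G F p T(1) Kb(1) T(2)] by meson
  show ?thesis
  proof (intro bexI[OF _ h(1)] ballI allI impI)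
    fix M B
    assume M: "M \<in> dual (LUC act)" and B: "B \<ge> 0" "\<forall>F\<in>LUC act. norm (M F) \<le> B * norm F"
    let ?g = "apply_bcontfun (orbit_fun act M F)"
    have int: "integrable p ?g"
      by (rule integrable_bcontfun[OF p])
    have sint: "set_integrable p C ?g" if "C \<in> sets borel" for C
      using that int p(2) unfolding set_integrable_def by (intro integrable_mult_indicator) auto
    have "norm (?g s) \<le> B * norm F" for s
      using norm_orbit_fun_le[OF G M F B(1)] B(2) norm_bounded[of "orbit_fun act M F" s]
      by (meson order_trans)
    then have "norm (LINT s:-K|p. ?g s) \<le> B * norm F * measure p (- K)"
      using Kb p int by (intro norm_set_integral_le) auto
    also have "\<dots> \<le> B * norm F * e"
      using K(2) B(1) by (intro mult_left_mono) auto
    finally have out: "norm (LINT s:-K|p. ?g s) \<le> B * norm F * e" .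
    have "norm (M h - (LINT s:K|p. ?g s)) \<le> B * e * measure p K"
      by (rule h(2)[OF M B])
    also have "\<dots> \<le> B * e * measure p UNIV"
      using B(1) e(1) p(2) by (intro mult_left_mono finite_measure_mono) auto
    finally have ins: "norm (M h - (LINT s:K|p. ?g s)) \<le> B * e * measure p UNIV" .
    have "(LINT s|p. ?g s) = (LINT s:K|p. ?g s) + (LINT s:-K|p. ?g s)"
      using set_integral_Un[of K "- K" p ?g] sint Kb
      by (simp add: set_lebesgue_integral_def)
    then have "norm (M h - (LINT s|p. ?g s)) \<le> norm (M h - (LINT s:K|p. ?g s)) + norm (LINT s:-K|p. ?g s)"
      by (metis diff_diff_eq norm_triangle_ineq4)
    also have "\<dots> \<le> B * (e * measure p UNIV + norm F * e)"
      using ins out by (simp add: algebra_simps)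
    also have "\<dots> \<le> B * \<epsilon>"
      using B(1) e(2) by (rule mult_left_mono[rotated])
    finally show "norm (M h - (LINT s|p. ?g s)) \<le> B * \<epsilon>" .
  qed
qed

text \<open>The element \<open>H\<close> is the integral of \<open>s \<mapsto> l\<^sub>s F\<close>. It is built by hand because the Bochner
  integral of the library requires a second countable target.\<close>

lemma translate_integral:
  fixes act :: "'g::{topological_group_add,t2_space} \<Rightarrow> 'x::t2_space \<Rightarrow> 'x"
  assumes G: "g_space act" and F: "F \<in> LUC act"
    and p: "finite_measure p" "sets p = sets borel"
    and tight: "\<And>e. 0 < e \<Longrightarrow> \<exists>K. compact K \<and> measure p (- K) \<le> e"
  obtains H where "H \<in> LUC act"
    "\<And>M. M \<in> dual (LUC act) \<Longrightarrow> M H = (LINT s|p. apply_bcontfun (orbit_fun act M F) s)"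
proof -
  define I where "I M = (LINT s|p. apply_bcontfun (orbit_fun act M F) s)" for M
  have "\<forall>n. \<exists>h\<in>LUC act. \<forall>M\<in>dual (LUC act). \<forall>B\<ge>0. (\<forall>F\<in>LUC act. norm (M F) \<le> B * norm F) \<longrightarrow>
    norm (M h - I M) \<le> B * inverse (real (Suc n))"
    unfolding I_def by (intro allI riemann_sum[OF G F p tight]) auto
  then obtain h where h: "\<And>n. h n \<in> LUC act"
    "\<And>n M B. M \<in> dual (LUC act) \<Longrightarrow> B \<ge> 0 \<Longrightarrow> (\<And>F. F \<in> LUC act \<Longrightarrow> norm (M F) \<le> B * norm F) \<Longrightarrow>
      norm (M (h n) - I M) \<le> B * inverse (real (Suc n))"
    by metis
  let ?E = "\<lambda>x. restrict (\<lambda>F. apply_bcontfun F x) (LUC act)"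
  \<comment> \<open>Applied to point evaluations, the estimate for \<open>h n\<close> does not
    depend on the point. The limit is thus uniform and again a bounded continuous function.\<close>
  have "uniform_limit UNIV (\<lambda>n. apply_bcontfun (h n)) (\<lambda>x. I (?E x)) sequentially"
  proof (rule uniform_limitI)
    fix e :: real assume "0 < e"
    have "norm (?E x (h n) - I (?E x)) \<le> 1 * inverse (real (Suc n))" for x n
      by (rule h(2)[OF evaluation_dual[OF G]]) (auto simp: norm_bounded)
    then have *: "dist (apply_bcontfun (h n) x) (I (?E x)) \<le> inverse (real (Suc n))" for x n
      by (simp add: dist_norm h(1) del: of_nat_Suc)
    have "\<forall>\<^sub>F n in sequentially. inverse (real (Suc n)) < e"
      using LIMSEQ_inverse_real_of_nat \<open>0 < e\<close> by (rule order_tendstoD)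
    then show "\<forall>\<^sub>F n in sequentially. \<forall>x\<in>UNIV. dist (apply_bcontfun (h n) x) (I (?E x)) < e"
      by eventually_elim (use * in \<open>blast intro: le_less_trans\<close>)
  qed
  from uniform_limit_bcontfunE[OF this sequentially_bot] obtain H where H: "h \<longlonglongrightarrow> H"
    by metis
  have HL: "H \<in> LUC act"
    by (rule LUC_tendsto[OF G h(1) H])
  have inv0: "(\<lambda>n. B * inverse (real (Suc n))) \<longlonglongrightarrow> 0" for B
    using tendsto_mult_right_zero[OF LIMSEQ_inverse_real_of_nat] .
  have "M H = I M" if M: "M \<in> dual (LUC act)" for M
  proof -
    obtain B where B: "0 \<le> B" "\<And>F. F \<in> LUC act \<Longrightarrow> norm (M F) \<le> B * norm F"
      using dual_bound[OF M] by blast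
    \<comment> \<open>\<open>M (h n)\<close> tends to \<open>I M\<close> by the choice of
      \<open>h\<close>, and to \<open>M H\<close> because \<open>M\<close> is bounded.\<close>
    have "(\<lambda>n. M (h n) - I M) \<longlonglongrightarrow> 0"
      by (rule Lim_null_comparison[OF _ inv0[of B]]) (simp add: h(2)[OF M B] del: of_nat_Suc)
    moreover have "(\<lambda>n. M (h n) - M H) \<longlonglongrightarrow> 0"
    proof (rule Lim_null_comparison)
      show "\<forall>\<^sub>F n in sequentially. norm (M (h n) - M H) \<le> B * norm (h n - H)"
        by (intro always_eventually allI)
          (simp add: B(2) diff_in_LUC G h(1) HL flip: dual_diff[OF G M])
      show "(\<lambda>n. B * norm (h n - H)) \<longlonglongrightarrow> 0"
        by (intro tendsto_mult_right_zero tendsto_norm_zero LIM_zero H)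
    qed
    ultimately show "M H = I M"
      by (rule LIMSEQ_unique[OF LIM_zero_cancel LIM_zero_cancel, THEN sym])
  qed
  with HL that show ?thesis
    by (auto simp: I_def)
qed

section \<open>Bounds for integrals against complex measures\<close>

lemma norm_integral_positive_part_le:
  fixes f :: "'g::t2_space \<Rightarrow>\<^sub>C complex"
  assumes nu: "signed_measure \<nu>" and K: "K \<in> sets borel"
    and c: "\<And>B. B \<in> sets borel \<Longrightarrow> B \<inter> K = {} \<Longrightarrow> \<bar>\<nu> B\<bar> \<le> c"
    and f: "\<And>s. s \<in> K \<Longrightarrow> apply_bcontfun f s = 0"
  shows "norm (integral\<^sup>L (positive_part \<nu>) (apply_bcontfun f)) \<le> c * norm f"
proof -
  note p = finite_measure_positive_part[OF nu] sets_positive_part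
  have K': "- K \<in> sets borel"
    using K by auto
  have "integral\<^sup>L (positive_part \<nu>) (apply_bcontfun f) = (LINT s:-K|positive_part \<nu>. apply_bcontfun f s)"
    unfolding set_lebesgue_integral_def using f
    by (intro Bochner_Integration.integral_cong refl) (auto simp: indicator_def)
  also have "norm \<dots> \<le> norm f * measure (positive_part \<nu>) (- K)"
    using K' by (intro norm_set_integral_le p integrable_bcontfun) (auto intro: norm_bounded)
  also have "\<dots> \<le> norm f * c"
    using K' c by (intro mult_left_mono measure_positive_part_le[OF nu]) auto
  finally show ?thesis
    by (simp add: mult.commute)
qed

text \<open>Each of the four positive variations has mass at most \<open>c\<close> off
  \<open>K\<close>, and \<open>f\<close> vanishes on \<open>K\<close>; hence the factor 4. With
  \<open>K\<close> empty this shows that measures are bounded functionals, with \<open>K\<close>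
  compact it exploits tightness.\<close>

lemma norm_complex_integral_le:
  fixes f :: "'g::t2_space \<Rightarrow>\<^sub>C complex"
  assumes mu: "complex_borel_measure \<mu>" and K: "K \<in> sets borel"
    and c: "\<And>B. B \<in> sets borel \<Longrightarrow> B \<inter> K = {} \<Longrightarrow> norm (\<mu> B) \<le> c"
    and f: "\<And>s. s \<in> K \<Longrightarrow> apply_bcontfun f s = 0"
  shows "norm (complex_integral \<mu> (apply_bcontfun f)) \<le> 4 * c * norm f"
proof -
  note nu = complex_borel_measure_Re_Im[OF mu]
  have le: "\<bar>Re (\<mu> B)\<bar> \<le> c" "\<bar>Im (\<mu> B)\<bar> \<le> c" "\<bar>- Re (\<mu> B)\<bar> \<le> c" "\<bar>- Im (\<mu> B)\<bar> \<le> c"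
    if "B \<in> sets borel" "B \<inter> K = {}" for B
    using c[OF that] abs_Re_le_cmod[of "\<mu> B"] abs_Im_le_cmod[of "\<mu> B"] by linarith+
  let ?I = "\<lambda>\<nu>. integral\<^sup>L (positive_part \<nu>) (apply_bcontfun f)"
  let ?a = "?I (\<lambda>E. Re (\<mu> E))" and ?b = "?I (\<lambda>E. - Re (\<mu> E))"
    and ?c = "?I (\<lambda>E. Im (\<mu> E))" and ?d = "?I (\<lambda>E. - Im (\<mu> E))"
  have "norm ?a \<le> c * norm f" "norm ?b \<le> c * norm f" "norm ?c \<le> c * norm f" "norm ?d \<le> c * norm f"
    using le by (intro norm_integral_positive_part_le[OF _ K] nu signed_measure_uminus f; blast)+
  moreover have "norm (?a - ?b + \<i> * (?c - ?d)) \<le> (norm ?a + norm ?b) + (norm ?c + norm ?d)"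
    by (rule order_trans[OF norm_triangle_ineq])
      (simp add: norm_mult add_mono norm_triangle_ineq4)
  ultimately show ?thesis
    unfolding complex_integral_def signed_integral_def by linarith
qed

lemma measure_functional_in_dual:
  assumes lc: "locally_compact_space (euclidean :: 'g::{topological_group_add,t2_space} topology)"
    and mu: "complex_borel_measure (\<mu> :: 'g set \<Rightarrow> complex)"
  shows "measure_functional \<mu> \<in> dual (LUC (+))"
proof -
  obtain C where C: "\<And>B. B \<in> sets borel \<Longrightarrow> norm (\<mu> B) \<le> C"
    using complex_borel_measure_bounded[OF mu] by blast
  note int = integrable_bcontfun[OF finite_measure_positive_part sets_positive_part]
  note nu = complex_borel_measure_Re_Im[OF mu]
  note ints = int[OF nu(1)] int[OF nu(2)] int[OF signed_measure_uminus[OF nu(1)]]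
    int[OF signed_measure_uminus[OF nu(2)]]
  note G = g_space_plus[OF lc]
  show ?thesis
  proof (rule dualI)
    show "measure_functional \<mu> (F + H) = measure_functional \<mu> F + measure_functional \<mu> H"
      if "F \<in> LUC (+)" "H \<in> LUC (+)" for F H
      using that by (simp add: measure_functional_def LUC_add G complex_integral_def
          signed_integral_def ints algebra_simps)
    show "measure_functional \<mu> (cscale c F) = c * measure_functional \<mu> F" if "F \<in> LUC (+)" for c F
    proof -
      have "apply_bcontfun (cscale c F) = (\<lambda>x. c * apply_bcontfun F x)"
        by auto
      with that show ?thesis
        by (simp add: measure_functional_def LUC_cscale G complex_integral_def
            signed_integral_def algebra_simps)
    qed
    show "norm (measure_functional \<mu> F) \<le> (4 * C) * norm F" if "F \<in> LUC (+)" for F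
      using that norm_complex_integral_le[OF mu, of "{}" C F] C
      by (simp add: measure_functional_def)
  qed (simp add: measure_functional_def)
qed

theorem measure_functionals_subset_top_centre:
  fixes act :: "'g::{topological_group_add,t2_space} \<Rightarrow> 'x::t2_space \<Rightarrow> 'x"
  assumes lc: "locally_compact_space (euclidean :: 'g topology)" and G: "g_space act"
  shows "measure_functionals \<subseteq> top_centre act"
proof
  fix m :: "('g \<Rightarrow>\<^sub>C complex) \<Rightarrow> complex" assume "m \<in> measure_functionals"
  then obtain \<mu> where mu: "complex_borel_measure \<mu>" "regular_measure \<mu>" and m: "m = measure_functional \<mu>"
    by (auto simp: measure_functionals_def)
  note nu = complex_borel_measure_Re_Im[OF mu(1)]
  show "m \<in> top_centre act"
  proof (rule top_centreI[OF lc G])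
    show "m \<in> dual (LUC (+))"
      unfolding m by (rule measure_functional_in_dual[OF lc mu(1)])
    fix F assume F: "F \<in> LUC act"
    \<comment> \<open>Domination by \<open>\<mu>\<close> passes tightness on to the positive
      variation, which treats all four parts of the measure alike.\<close>
    have ex: "\<exists>H\<in>LUC act. \<forall>M\<in>dual (LUC act).
        M H = integral\<^sup>L (positive_part \<nu>) (apply_bcontfun (orbit_fun act M F))"
      if nu: "signed_measure \<nu>" and le: "\<And>E. \<bar>\<nu> E\<bar> \<le> norm (\<mu> E)" for \<nu>
    proof -
      have "\<exists>K. compact K \<and> measure (positive_part \<nu>) (- K) \<le> e" if "0 < e" for e
      proof -
        obtain K where K: "compact K" "\<And>B. B \<in> sets borel \<Longrightarrow> B \<inter> K = {} \<Longrightarrow> norm (\<mu> B) \<le> e"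
          using regular_measure_tight[OF mu \<open>0 < e\<close>] by blast
        have "measure (positive_part \<nu>) (- K) \<le> e"
          using K le by (intro measure_positive_part_le[OF nu])
            (auto simp: borel_closed compact_imp_closed intro: order_trans)
        with K(1) show ?thesis by blast
      qed
      then show ?thesis
        using translate_integral[OF G F finite_measure_positive_part[OF nu] sets_positive_part]
        by metis
    qed
    obtain H1 where H1: "H1 \<in> LUC act" "\<And>M. M \<in> dual (LUC act) \<Longrightarrow> M H1 =
        integral\<^sup>L (positive_part (\<lambda>E. Re (\<mu> E))) (apply_bcontfun (orbit_fun act M F))"
      using ex[OF nu(1)] abs_Re_le_cmod by blast
    obtain H2 where H2: "H2 \<in> LUC act" "\<And>M. M \<in> dual (LUC act) \<Longrightarrow> M H2 =
        integral\<^sup>L (positive_part (\<lambda>E. - Re (\<mu> E))) (apply_bcontfun (orbit_fun act M F))"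
      using ex[OF signed_measure_uminus[OF nu(1)]] abs_Re_le_cmod by auto
    obtain H3 where H3: "H3 \<in> LUC act" "\<And>M. M \<in> dual (LUC act) \<Longrightarrow> M H3 =
        integral\<^sup>L (positive_part (\<lambda>E. Im (\<mu> E))) (apply_bcontfun (orbit_fun act M F))"
      using ex[OF nu(2)] abs_Im_le_cmod by blast
    obtain H4 where H4: "H4 \<in> LUC act" "\<And>M. M \<in> dual (LUC act) \<Longrightarrow> M H4 =
        integral\<^sup>L (positive_part (\<lambda>E. - Im (\<mu> E))) (apply_bcontfun (orbit_fun act M F))"
      using ex[OF signed_measure_uminus[OF nu(2)]] abs_Im_le_cmod by auto
    show "\<exists>H\<in>LUC act. \<forall>M\<in>dual (LUC act). m (orbit_fun act M F) = M H"
    \<comment> \<open>The witness combines the four integrals in the same way as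
      \<open>complex_integral\<close> does.\<close>
    proof (intro bexI[of _ "(H1 - H2) + cscale \<i> (H3 - H4)"] ballI)
      fix M assume M: "M \<in> dual (LUC act)"
      have "M ((H1 - H2) + cscale \<i> (H3 - H4)) = (M H1 - M H2) + \<i> * (M H3 - M H4)"
        by (simp add: dual_add[OF M] dual_cscale[OF M] dual_diff[OF G M] diff_in_LUC G LUC_cscale
            H1(1) H2(1) H3(1) H4(1))
      also have "\<dots> = m (orbit_fun act M F)"
        by (simp add: m measure_functional_def orbit_fun_in_LUC[OF lc G M F] complex_integral_def
            signed_integral_def H1(2)[OF M] H2(2)[OF M] H3(2)[OF M] H4(2)[OF M])
      finally show "m (orbit_fun act M F) = M ((H1 - H2) + cscale \<i> (H3 - H4))"
        by simp
    qed (intro LUC_add diff_in_LUC LUC_cscale G H1 H2 H3 H4)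
  qed
qed

subsection \<open>Functions on the group\<close>

lemma Hausdorff_space_euclidean_t2: "Hausdorff_space (euclidean :: 'a::t2_space topology)"
  unfolding Hausdorff_space_def disjnt_def by (simp add: separation_t2)

lemma compact_neighbourhood:
  fixes K :: "'a::t2_space set"
  assumes "locally_compact_space (euclidean :: 'a topology)" "compact K"
  obtains U L where "open U" "compact L" "K \<subseteq> U" "U \<subseteq> L"
proof -
  have "\<exists>U L. open U \<and> compact L \<and> closed L \<and> K \<subseteq> U \<and> U \<subseteq> L"
    using assms Hausdorff_space_euclidean_t2
      locally_compact_space_compact_closed_compact[of "euclidean :: 'a topology"]
    by (auto simp flip: closed_closedin)
  with that show ?thesis by blast
qed

text \<open>Urysohn's lemma for a compact and a closed set, in the completely regular space at hand.
  The function is made to vanish off \<open>U \<inter> V\<close> with \<open>V\<close> inside a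
  compact set, which gives the compact support.\<close>

lemma bump_function:
  fixes K :: "'a::t2_space set"
  assumes lc: "locally_compact_space (euclidean :: 'a topology)" and K: "compact K"
    and U: "open U" "K \<subseteq> U"
  obtains h :: "'a \<Rightarrow> real" and L where "continuous_on UNIV h" "\<And>x. 0 \<le> h x" "\<And>x. h x \<le> 1"
    "\<And>x. x \<in> K \<Longrightarrow> h x = 1" "\<And>x. x \<notin> U \<Longrightarrow> h x = 0" "compact L" "\<And>x. x \<notin> L \<Longrightarrow> h x = 0"
proof -
  obtain V L where V: "open V" "compact L" "K \<subseteq> V" "V \<subseteq> L"
    using compact_neighbourhood[OF lc K] .
  have "completely_regular_space (euclidean :: 'a topology)"
    using lc Hausdorff_space_euclidean_t2
    by (intro locally_compact_regular_imp_completely_regular_space) auto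
  moreover have "closed (- (U \<inter> V))"
    using U V by auto
  moreover have "disjnt K (- (U \<inter> V))"
    using U V by (auto simp: disjnt_def)
  ultimately obtain h where h: "continuous_map euclidean (top_of_set {0..1::real}) h"
      "h ` (- (U \<inter> V)) \<subseteq> {0}" "h ` K \<subseteq> {1}"
    using Urysohn_completely_regular_compact_closed[of 0 "1::real" "euclidean :: 'a topology" K "- (U \<inter> V)"] K
    by auto
  show ?thesis
  proof (rule that[of h L])
    show "continuous_on UNIV h"
      using h(1) by (auto simp: continuous_map_in_subtopology)
    show "0 \<le> h x" "h x \<le> 1" for x
      using h(1) by (auto simp: continuous_map_in_subtopology Pi_iff)
    show "h x = 1" if "x \<in> K" for x
      using that h(3) by auto
    show "h x = 0" if "x \<notin> U" for x
      using that h(2) by auto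
    show "h x = 0" if "x \<notin> L" for x
      using that h(2) V(4) by auto
  qed (rule V(2))
qed

text \<open>The perturbation \<open>u\<close> stands on the left of \<open>x\<close>, as in the
  translates defining \<open>LUC (+)\<close>; bounded functions with this property belong to that
  space.\<close>

definition right_uniformly_continuous ::
    "('g::topological_group_add \<Rightarrow> 'b::metric_space) \<Rightarrow> bool" where
  "right_uniformly_continuous f \<longleftrightarrow>
     (\<forall>e>0. \<exists>W. open W \<and> 0 \<in> W \<and> (\<forall>u\<in>W. \<forall>x. dist (f (u + x)) (f x) \<le> e))"

text \<open>Since \<open>s + x = (s - t) + (t + x)\<close>, the condition at the identity applies
  with \<open>u = s - t\<close>.\<close>

lemma right_uniformly_continuous_at:
  assumes "right_uniformly_continuous f" "0 < e"
  shows "\<forall>\<^sub>F s in nhds t. \<forall>x. dist (f (s + x)) (f (t + x)) \<le> e"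
proof -
  obtain W where W: "open W" "0 \<in> W" "\<And>u x. u \<in> W \<Longrightarrow> dist (f (u + x)) (f x) \<le> e"
    using assms unfolding right_uniformly_continuous_def by metis
  have "((\<lambda>s. s - t) \<longlongrightarrow> t - t) (nhds t)"
    by (intro tendsto_diff tendsto_const) (rule filterlim_ident)
  from topological_tendstoD[OF this W(1)] W(2) have "\<forall>\<^sub>F s in nhds t. s - t \<in> W"
    by simp
  then show ?thesis
  proof eventually_elim
    case (elim s)
    have "dist (f ((s - t) + (t + x))) (f (t + x)) \<le> e" for x
      by (rule W(3)[OF elim])
    then show ?case
      by (simp add: add.assoc[symmetric])
  qed
qed

lemma right_uniformly_continuous_imp_continuous:
  assumes "right_uniformly_continuous f"
  shows "continuous_on UNIV f"
  unfolding continuous_on_def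
proof (intro ballI tendstoI)
  fix t :: 'a and e :: real assume "0 < e"
  then have "\<forall>\<^sub>F s in nhds t. \<forall>x. dist (f (s + x)) (f (t + x)) \<le> e / 2"
    by (intro right_uniformly_continuous_at assms) simp
  then have "\<forall>\<^sub>F s in nhds t. dist (f s) (f t) < e"
    by eventually_elim (use \<open>0 < e\<close> in \<open>auto dest: spec[of _ 0]\<close>)
  then show "\<forall>\<^sub>F s in at t within UNIV. dist (f s) (f t) < e"
    by (auto simp: eventually_at_filter elim: eventually_mono)
qed

lemma right_uniformly_continuous_in_LUC:
  fixes f :: "'g::{topological_group_add,t2_space} \<Rightarrow> complex"
  assumes lc: "locally_compact_space (euclidean :: 'g topology)"
    and f: "right_uniformly_continuous f" "bounded (range f)"
  obtains F where "F \<in> LUC (+)" "apply_bcontfun F = f"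
proof -
  have "f \<in> bcontfun"
    using f by (simp add: bcontfun_def right_uniformly_continuous_imp_continuous)
  then obtain F where F: "apply_bcontfun F = f"
    by (metis Bcontfun_inverse)
  have "F \<in> LUC (+)"
    unfolding LUC_def mem_Collect_eq continuous_on_def
  proof (intro ballI tendstoI)
    fix t :: 'g and e :: real assume "0 < e"
    then have "\<forall>\<^sub>F s in nhds t. \<forall>x. dist (f (s + x)) (f (t + x)) \<le> e / 2"
      by (intro right_uniformly_continuous_at f) simp
    then have "\<forall>\<^sub>F s in nhds t. dist (translate (+) s F) (translate (+) t F) < e"
    proof eventually_elim
      case (elim s)
      then have "dist (translate (+) s F) (translate (+) t F) \<le> e / 2"
        by (intro dist_bound) (simp add: apply_translate[OF g_space_plus[OF lc]] F)
      with \<open>0 < e\<close> show ?case by simp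
    qed
    then show "\<forall>\<^sub>F s in at t within UNIV. dist (translate (+) s F) (translate (+) t F) < e"
      by (auto simp: eventually_at_filter elim: eventually_mono)
  qed
  with F that show ?thesis by blast
qed

lemma compact_set_plus:
  fixes A B :: "'g::topological_group_add set"
  assumes "compact A" "compact B"
  shows "compact ((\<lambda>(a, b). a + b) ` (A \<times> B))"
  using assms by (intro compact_continuous_image compact_Times)
    (auto simp: case_prod_beta intro!: continuous_intros)

lemma compact_uminus_image:
  fixes A :: "'g::topological_group_add set"
  shows "compact A \<Longrightarrow> compact (uminus ` A)"
  by (intro compact_continuous_image continuous_intros)

text \<open>The tube lemma gives a neighbourhood of the identity that works for all \<open>x\<close>
  in a compact set; outside a large enough compact set both values are 0.\<close>

lemma right_uniformly_continuous_compact_support: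
  fixes f :: "'g::{topological_group_add,t2_space} \<Rightarrow> 'b::real_normed_vector"
  assumes lc: "locally_compact_space (euclidean :: 'g topology)"
    and f: "continuous_on UNIV f" and K: "compact K" "\<And>x. x \<notin> K \<Longrightarrow> f x = 0"
  shows "right_uniformly_continuous f"
  unfolding right_uniformly_continuous_def
proof (intro allI impI)
  fix e :: real assume "0 < e"
  obtain V C where V: "open V" "compact C" "{0 :: 'g} \<subseteq> V" "V \<subseteq> C"
    using compact_neighbourhood[OF lc, of "{0}"] by auto
  \<comment> \<open>Besides \<open>K\<close> this contains \<open>- u + K\<close> for all
    \<open>u\<close> in \<open>V\<close>, so for \<open>x\<close> outside it both \<open>x\<close>
    and \<open>u + x\<close> miss \<open>K\<close>.\<close>
  define K' where "K' = (\<lambda>(a, b). a + b) ` (uminus ` C \<times> K) \<union> K"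
  have "compact K'"
    unfolding K'_def by (intro compact_Un compact_set_plus compact_uminus_image V K)
  moreover have "open {z. dist (f (fst z + snd z)) (f (snd z)) < e}"
    by (intro open_Collect_less continuous_intros continuous_on_compose2[OF f]) auto
  moreover have "{0} \<times> K' \<subseteq> {z. dist (f (fst z + snd z)) (f (snd z)) < e}"
    using \<open>0 < e\<close> by auto
  ultimately obtain X where X: "0 \<in> X" "open X" "X \<times> K' \<subseteq> {z. dist (f (fst z + snd z)) (f (snd z)) < e}"
    using Elementary_Topology.tube_lemma[of K' _ 0] by blast
  have "dist (f (u + x)) (f x) \<le> e" if u: "u \<in> X \<inter> V" for u x
  proof (cases "x \<in> K'")
    case True
    with X(3) u have "(u, x) \<in> {z. dist (f (fst z + snd z)) (f (snd z)) < e}"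
      by blast
    then show ?thesis by simp
  next
    case False
    have "u + x \<notin> K"
    proof
      assume "u + x \<in> K"
      then have "- u + (u + x) \<in> K'"
        using u V(4) unfolding K'_def by (intro UnI1 image_eqI[of _ _ "(- u, u + x)"]) auto
      with False show False by simp
    qed
    then show ?thesis
      using False K(2) \<open>0 < e\<close> by (simp add: K'_def)
  qed
  with X V show "\<exists>W. open W \<and> 0 \<in> W \<and> (\<forall>u\<in>W. \<forall>x. dist (f (u + x)) (f x) \<le> e)"
    by (intro exI[of _ "X \<inter> V"]) auto
qed

text \<open>Perturbations act on the left and \<open>s\<close> is subtracted on the right, so the
  neighbourhood found for \<open>\<phi>\<close> serves all the functions under the supremum
  simultaneously.\<close>

lemma right_uniformly_continuous_SUP:
  fixes \<phi> :: "'g::topological_group_add \<Rightarrow> real"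
  assumes phi: "right_uniformly_continuous \<phi>" "\<And>x. \<phi> x \<le> 1" and S: "S \<noteq> {}"
  shows "right_uniformly_continuous (\<lambda>x. SUP s\<in>S. \<phi> (x - s))"
  unfolding right_uniformly_continuous_def
proof (intro allI impI)
  fix e :: real assume "0 < e"
  then obtain W where W: "open W" "0 \<in> W" "\<And>u x. u \<in> W \<Longrightarrow> dist (\<phi> (u + x)) (\<phi> x) \<le> e"
    using phi(1) unfolding right_uniformly_continuous_def by metis
  have bdd: "bdd_above ((\<lambda>s. \<phi> (x - s)) ` S)" for x
    using phi(2) by (intro bdd_aboveI2)
  have "dist (SUP s\<in>S. \<phi> (u + x - s)) (SUP s\<in>S. \<phi> (x - s)) \<le> e" if u: "u \<in> W" for u x
  proof -
    have close: "\<bar>\<phi> (u + x - s) - \<phi> (x - s)\<bar> \<le> e" for s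
      using W(3)[OF u, of "x - s"] by (simp add: dist_real_def add_diff_eq)
    have "(SUP s\<in>S. \<phi> (u + x - s)) \<le> (SUP s\<in>S. \<phi> (x - s)) + e"
    proof (rule cSUP_least[OF S])
      fix s assume "s \<in> S"
      then have "\<phi> (x - s) \<le> (SUP s\<in>S. \<phi> (x - s))"
        by (rule cSUP_upper[OF _ bdd])
      with close[of s] show "\<phi> (u + x - s) \<le> (SUP s\<in>S. \<phi> (x - s)) + e" by linarith
    qed
    moreover have "(SUP s\<in>S. \<phi> (x - s)) \<le> (SUP s\<in>S. \<phi> (u + x - s)) + e"
    proof (rule cSUP_least[OF S])
      fix s assume "s \<in> S"
      then have "\<phi> (u + x - s) \<le> (SUP s\<in>S. \<phi> (u + x - s))"
        by (rule cSUP_upper[OF _ bdd])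
      with close[of s] show "\<phi> (x - s) \<le> (SUP s\<in>S. \<phi> (u + x - s)) + e" by linarith
    qed
    ultimately show ?thesis
      by (simp add: dist_real_def abs_le_iff)
  qed
  with W show "\<exists>W. open W \<and> 0 \<in> W \<and> (\<forall>u\<in>W. \<forall>x. dist (SUP s\<in>S. \<phi> (u + x - s)) (SUP s\<in>S. \<phi> (x - s)) \<le> e)"
    by blast
qed

text \<open>Zorn's lemma provides a maximal set with the separation property. If it lay in a compact
  \<open>K\<close>, maximality would make the group the sum of \<open>K\<close> and the compact set
  of 0, \<open>W\<close> and \<open>- W\<close>, hence compact.\<close>

lemma separated_set:
  fixes W :: "'g::topological_group_add set"
  assumes W: "compact W" and nc: "\<not> compact (UNIV :: 'g set)"
  obtains S where "\<And>s t. s \<in> S \<Longrightarrow> t \<in> S \<Longrightarrow> s \<noteq> t \<Longrightarrow> s - t \<notin> W"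
    "\<And>K. compact K \<Longrightarrow> \<not> S \<subseteq> K"
proof -
  let ?sep = "{S. \<forall>s\<in>S. \<forall>t\<in>S. s \<noteq> t \<longrightarrow> s - t \<notin> W}"
  have "\<exists>S\<in>?sep. \<forall>X\<in>?sep. S \<subseteq> X \<longrightarrow> X = S"
  proof (rule subset_Zorn')
    fix C assume C: "subset.chain ?sep C"
    have "s - t \<notin> W" if "X \<in> C" "Y \<in> C" "s \<in> X" "t \<in> Y" "s \<noteq> t" for X Y s t
    proof -
      obtain Z where "Z \<in> C" "s \<in> Z" "t \<in> Z"
        using C \<open>X \<in> C\<close> \<open>Y \<in> C\<close> \<open>s \<in> X\<close> \<open>t \<in> Y\<close> unfolding subset_chain_def by (metis subsetD)
      with C \<open>s \<noteq> t\<close> show ?thesis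
        unfolding subset_chain_def by blast
    qed
    then show "\<Union>C \<in> ?sep"
      by auto
  qed
  then obtain S where S: "S \<in> ?sep" "\<forall>X\<in>?sep. S \<subseteq> X \<longrightarrow> X = S"
    by (rule bexE)
  show ?thesis
  proof (rule that)
    show "s - t \<notin> W" if "s \<in> S" "t \<in> S" "s \<noteq> t" for s t
      using S(1) that by blast
    show "\<not> S \<subseteq> K" if K: "compact K" for K
    proof
      assume SK: "S \<subseteq> K"
      \<comment> \<open>The element 0 accounts for \<open>g\<close> in \<open>S\<close>, and the
        negatives for a violation in which \<open>g\<close> is the subtracted point.\<close>
      let ?W = "insert 0 (W \<union> uminus ` W)"
      have "g \<in> (\<lambda>(a, b). a + b) ` (?W \<times> K)" for g
      proof -
        have "\<exists>s\<in>S. g - s \<in> ?W"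
        proof (cases "g \<in> S")
          case True
          then show ?thesis by (intro bexI[of _ g]) auto
        next
          case False
          then have "insert g S \<notin> ?sep"
            using S(2)[rule_format, of "insert g S"] by blast
          then obtain s where "s \<in> S" "g - s \<in> W \<or> s - g \<in> W"
            using S(1) by auto
          moreover have "g - s = - (s - g)"
            by simp
          ultimately show ?thesis
            by (metis UnI1 UnI2 image_eqI insertI2)
        qed
        then obtain s where s: "s \<in> S" "g - s \<in> ?W"
          by blast
        then show ?thesis
          using SK by (intro image_eqI[of _ _ "(g - s, s)"]) auto
      qed
      then have "(\<lambda>(a, b). a + b) ` (?W \<times> K) = UNIV"
        by blast
      moreover have "compact ((\<lambda>(a, b). a + b) ` (?W \<times> K))"
        by (intro compact_set_plus compact_insert compact_Un compact_uminus_image W K)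
      ultimately show False
        using nc by simp
    qed
  qed
qed

subsection \<open>A functional that is not a measure\<close>

text \<open>The restriction of the values to \<open>{0..1}\<close> serves later: it keeps F at norm
  at most 1 after a cut-off.\<close>

lemma LUC_separating_function:
  fixes n :: "'g::{topological_group_add,t2_space}"
  assumes lc: "locally_compact_space (euclidean :: 'g topology)"
    and nc: "\<not> compact (UNIV :: 'g set)" and n: "n \<noteq> 0"
  obtains F S where "F \<in> LUC (+)" "\<And>x. \<exists>r\<in>{0..1}. apply_bcontfun F x = complex_of_real r"
    "\<And>s. s \<in> S \<Longrightarrow> apply_bcontfun F s = 1" "\<And>s. s \<in> S \<Longrightarrow> apply_bcontfun F (n + s) = 0"
    "\<And>K. compact K \<Longrightarrow> \<not> S \<subseteq> K"
proof -
  obtain \<phi> L where phi: "continuous_on UNIV \<phi>" "\<And>x. 0 \<le> \<phi> x" "\<And>x. \<phi> x \<le> 1"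
    "\<And>x. x \<in> {0} \<Longrightarrow> \<phi> x = (1::real)" "\<And>x. x \<notin> - {n} \<Longrightarrow> \<phi> x = 0" "compact L" "\<And>x. x \<notin> L \<Longrightarrow> \<phi> x = 0"
  proof (rule bump_function[OF lc, of "{0}" "- {n}"])
    show "open (- {n})" by (intro open_Compl closed_singleton)
  qed (use n in auto)
  \<comment> \<open>For distinct \<open>s\<close> and \<open>t\<close> in \<open>S\<close>,
    \<open>n + s - t\<close> could lie in \<open>L\<close> only if \<open>s - t\<close> were in this
    set. For \<open>s = t\<close> the value is \<open>\<phi> n = 0\<close>.\<close>
  have "compact ((\<lambda>y. - n + y) ` L)"
    by (intro compact_continuous_image continuous_intros phi(6))
  then obtain S where S: "\<And>s t. s \<in> S \<Longrightarrow> t \<in> S \<Longrightarrow> s \<noteq> t \<Longrightarrow> s - t \<notin> (\<lambda>y. - n + y) ` L"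
    "\<And>K. compact K \<Longrightarrow> \<not> S \<subseteq> K"
    using separated_set[OF _ nc] by metis
  have ne: "S \<noteq> {}"
    using S(2)[of "{}"] by auto
  define f where "f x = (SUP s\<in>S. \<phi> (x - s))" for x
  have bdd: "bdd_above ((\<lambda>s. \<phi> (x - s)) ` S)" for x
    using phi(3) by (intro bdd_aboveI2)
  have f1: "f x \<le> 1" for x
    unfolding f_def using ne phi(3) by (intro cSUP_least) auto
  have f0: "0 \<le> f x" for x
  proof -
    obtain s where s: "s \<in> S" using ne by blast
    have "0 \<le> \<phi> (x - s)" by (rule phi(2))
    also have "\<dots> \<le> f x" unfolding f_def by (rule cSUP_upper[OF s bdd])
    finally show ?thesis .
  qed
  have "right_uniformly_continuous \<phi>"
    by (rule right_uniformly_continuous_compact_support[OF lc phi(1,6,7)])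
  then have "right_uniformly_continuous f"
    unfolding f_def by (rule right_uniformly_continuous_SUP[OF _ phi(3) ne])
  then have "right_uniformly_continuous (\<lambda>x. complex_of_real (f x))"
    unfolding right_uniformly_continuous_def dist_of_real .
  moreover have "bounded (range (\<lambda>x. complex_of_real (f x)))"
    using f0 f1 by (intro boundedI[of _ 1]) auto
  ultimately obtain F where F: "F \<in> LUC (+)" "apply_bcontfun F = (\<lambda>x. complex_of_real (f x))"
    by (rule right_uniformly_continuous_in_LUC[OF lc])
  show ?thesis
  proof (rule that[OF F(1) _ _ _ S(2)])
    show "\<exists>r\<in>{0..1}. apply_bcontfun F x = complex_of_real r" for x
      using f0 f1 by (auto simp: F(2))
    fix s assume s: "s \<in> S"
    have "\<phi> (s - s) \<le> f s"
      unfolding f_def by (rule cSUP_upper[OF s bdd])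
    then show "apply_bcontfun F s = 1"
      using f1[of s] phi(4)[of 0] by (simp add: F(2))
    have "\<phi> (n + s - t) = 0" if t: "t \<in> S" for t
    proof (cases "s = t")
      case True
      then show ?thesis using phi(5)[of n] by (simp add: add_diff_eq[symmetric])
    next
      case False
      have "n + s - t \<notin> L"
      proof
        assume "n + s - t \<in> L"
        then have "- n + (n + s - t) \<in> (\<lambda>y. - n + y) ` L" by (rule imageI)
        also have "- n + (n + s - t) = s - t" by (simp add: add_diff_eq[symmetric])
        finally show False using S(1)[OF s t False] by simp
      qed
      then show ?thesis by (rule phi(7))
    qed
    then have "f (n + s) \<le> 0"
      unfolding f_def using ne by (intro cSUP_least) auto
    then show "apply_bcontfun F (n + s) = 0"
      using f0[of "n + s"] by (simp add: F(2))
  qed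
qed

text \<open>\<open>m\<close> is a pointwise limit of the functionals \<open>f \<mapsto> f s - f (n + s)\<close> as \<open>s \<in> S\<close> leaves every
  compact set; it exists by Tychonoff's theorem.\<close>

lemma limit_functional:
  fixes n :: "'g::{topological_group_add,t2_space}" and F :: "'g \<Rightarrow>\<^sub>C complex"
  assumes S: "\<And>K. compact K \<Longrightarrow> \<not> S \<subseteq> K"
    and F: "\<And>s. s \<in> S \<Longrightarrow> apply_bcontfun F s = 1" "\<And>s. s \<in> S \<Longrightarrow> apply_bcontfun F (n + s) = 0"
  obtains m :: "('g \<Rightarrow>\<^sub>C complex) \<Rightarrow> complex" where
    "\<And>f. norm (m f) \<le> 2 * norm f" "\<And>f g. m (f + g) = m f + m g" "\<And>c f. m (cscale c f) = c * m f"
    "m F = 1" "\<And>f. (\<And>x. apply_bcontfun f (n + x) = apply_bcontfun f x) \<Longrightarrow> m f = 0"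
    "\<And>f K. compact K \<Longrightarrow> (\<And>x. x \<notin> K \<Longrightarrow> apply_bcontfun f x = 0) \<Longrightarrow> m f = 0"
proof -
  \<comment> \<open>\<open>P\<close> is a product of discs, compact by Tychonoff. Each
    \<open>C K\<close> consists of equations in finitely many coordinates and is closed, so the
    finite intersection property applies.\<close>
  define P where "P = {m :: ('g \<Rightarrow>\<^sub>C complex) \<Rightarrow> complex. \<forall>f. m f \<in> cball 0 (2 * norm f)}"
  define C where "C K = {m :: ('g \<Rightarrow>\<^sub>C complex) \<Rightarrow> complex.
    (\<forall>f g. m (f + g) = m f + m g) \<and> (\<forall>c f. m (cscale c f) = c * m f) \<and> m F = 1 \<and>
    (\<forall>f. (\<forall>x. apply_bcontfun f (n + x) = apply_bcontfun f x) \<longrightarrow> m f = 0) \<and>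
    (\<forall>f. (\<forall>x. x \<notin> K \<longrightarrow> apply_bcontfun f x = 0) \<longrightarrow> m f = 0)}" for K :: "'g set"
  have "compactin (product_topology (\<lambda>_. euclidean) UNIV) (PiE UNIV (\<lambda>f :: 'g \<Rightarrow>\<^sub>C complex. cball (0::complex) (2 * norm f)))"
    by (simp add: compactin_PiE)
  then have "compact P"
    by (simp add: euclidean_product_topology P_def PiE_UNIV_domain Pi_def)
  moreover have "closed (C K)" for K
    unfolding C_def
    by (intro closed_Collect_conj closed_Collect_all closed_Collect_imp open_Collect_const
        closed_Collect_eq continuous_on_add continuous_on_mult continuous_on_const
        continuous_on_product_coordinates)
  moreover have "P \<inter> (\<Inter>K\<in>I. C K) \<noteq> {}" if I: "finite I" "I \<subseteq> Collect compact" for I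
  proof -
    let ?K = "\<Union>I"
    have "compact ?K"
      using I by (intro compact_Union) auto
    \<comment> \<open>Avoiding the shifted copy as well ensures that \<open>n + s\<close>, like
      \<open>s\<close>, lies outside all the given compact sets.\<close>
    then have "compact (?K \<union> (\<lambda>y. - n + y) ` ?K)"
      by (intro compact_Un compact_continuous_image continuous_intros)
    from S[OF this] obtain s where s: "s \<in> S" "s \<notin> ?K" "s \<notin> (\<lambda>y. - n + y) ` ?K"
      by blast
    have ns: "n + s \<notin> ?K"
    proof
      assume "n + s \<in> ?K"
      then have "- n + (n + s) \<in> (\<lambda>y. - n + y) ` ?K" by (rule imageI)
      with s(3) show False by simp
    qed
    let ?m = "\<lambda>f :: 'g \<Rightarrow>\<^sub>C complex. apply_bcontfun f s - apply_bcontfun f (n + s)"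
    have "norm (?m f) \<le> 2 * norm f" for f
      using norm_triangle_ineq4[of "apply_bcontfun f s" "apply_bcontfun f (n + s)"]
        norm_bounded[of f s] norm_bounded[of f "n + s"] by linarith
    then have "?m \<in> P"
      by (simp add: P_def)
    moreover have "?m \<in> C K" if "K \<in> I" for K
    proof -
      have "s \<notin> K" "n + s \<notin> K"
        using s(2) ns that by auto
      then show ?thesis
        using s(1) by (simp add: C_def F algebra_simps)
    qed
    ultimately show ?thesis by blast
  qed
  ultimately have "P \<inter> (\<Inter>K\<in>Collect compact. C K) \<noteq> {}"
    by (rule compact_imp_fip_image)
  then obtain m where m: "m \<in> P" "\<And>K. compact K \<Longrightarrow> m \<in> C K"
    by auto
  show ?thesis
  proof (rule that[of m])
    show "norm (m f) \<le> 2 * norm f" for f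
      using m(1) by (simp add: P_def)
    show "m f = 0" if "compact K" "\<And>x. x \<notin> K \<Longrightarrow> apply_bcontfun f x = 0" for f K
      using m(2)[OF that(1)] that(2) by (simp add: C_def)
  qed (use m(2)[OF compact_empty] in \<open>simp_all add: C_def\<close>)
qed

theorem corollary4p8:
  fixes act :: "'g::{topological_group_add,t2_space} \<Rightarrow> 'x::t2_space \<Rightarrow> 'x"
  assumes "locally_compact_space (euclidean :: 'g topology)"
    and "\<not> compact (UNIV :: 'g set)"
    and "g_space act"
    and "\<not> effective act"
  shows "(measure_functionals :: (('g \<Rightarrow>\<^sub>C complex) \<Rightarrow> complex) set) \<subset> top_centre act"
proof -
  note lc = assms(1) and nc = assms(2) and G = assms(3)
  have "0 \<in> action_kernel act"
    using G by (simp add: action_kernel_def g_space_def)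
  then obtain n where n: "n \<noteq> 0" "\<And>x. act n x = x"
    using assms(4) by (auto simp: effective_def action_kernel_def)
  obtain F S where F: "F \<in> LUC (+)" "\<And>x. \<exists>r\<in>{0..1}. apply_bcontfun F x = complex_of_real r"
    "\<And>s. s \<in> S \<Longrightarrow> apply_bcontfun F s = 1" "\<And>s. s \<in> S \<Longrightarrow> apply_bcontfun F (n + s) = 0"
    and S: "\<And>K. compact K \<Longrightarrow> \<not> S \<subseteq> K"
    using LUC_separating_function[OF lc nc n(1)] by blast
  obtain m :: "('g \<Rightarrow>\<^sub>C complex) \<Rightarrow> complex" where
    m: "\<And>f. norm (m f) \<le> 2 * norm f" "\<And>f g. m (f + g) = m f + m g" "\<And>c f. m (cscale c f) = c * m f"
    "m F = 1" "\<And>f. (\<And>x. apply_bcontfun f (n + x) = apply_bcontfun f x) \<Longrightarrow> m f = 0"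
    "\<And>f K. compact K \<Longrightarrow> (\<And>x. x \<notin> K \<Longrightarrow> apply_bcontfun f x = 0) \<Longrightarrow> m f = 0"
    using limit_functional[of S F n, OF S F(3,4)] by blast
  \<comment> \<open>\<open>m\<close> is defined on all bounded continuous functions, whereas members
    of \<open>dual\<close> are \<open>undefined\<close> outside their subspace.\<close>
  define m' where "m' = restrict m (LUC (+))"
  have m'_dual: "m' \<in> dual (LUC (+))"
    by (rule dualI[where B = 2]) (simp_all add: m'_def m LUC_add LUC_cscale g_space_plus lc)
  have "m' \<in> top_centre act"
  proof (rule top_centreI[OF lc G m'_dual], intro bexI ballI)
    fix H M assume H: "H \<in> LUC act" and M: "M \<in> dual (LUC act)"
    \<comment> \<open>As \<open>n\<close> acts trivially, MH is invariant under \<open>n\<close>,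
      where \<open>m\<close> vanishes. So the element representing the functional is 0.\<close>
    have "translate act (n + x) H = translate act x H" for x
      using G by (intro bcontfun_eqI) (simp add: apply_translate g_space_def n(2))
    then have "m (orbit_fun act M H) = 0"
      by (intro m(5)) (simp add: apply_orbit_fun[OF G M H])
    then show "m' (orbit_fun act M H) = M 0"
      by (simp add: m'_def orbit_fun_in_LUC[OF lc G M H] dual_zero[OF M G])
  qed (rule LUC_zero[OF G])
  moreover have "m' \<notin> measure_functionals"
  proof
    assume "m' \<in> measure_functionals"
    then obtain \<mu> where mu: "complex_borel_measure \<mu>" "regular_measure \<mu>" "m' = measure_functional \<mu>"
      by (auto simp: measure_functionals_def)
    \<comment> \<open>With 1/8 the factor 4 leaves the bound 1/2, strictly below the value 1 that
      \<open>m'\<close> will take.\<close>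
    obtain K where K: "compact K" "\<And>B. B \<in> sets borel \<Longrightarrow> B \<inter> K = {} \<Longrightarrow> norm (\<mu> B) \<le> 1 / 8"
      using regular_measure_tight[OF mu(1,2), of "1 / 8"] by auto
    obtain h :: "'g \<Rightarrow> real" and L where h: "continuous_on UNIV h" "\<And>x. 0 \<le> h x" "\<And>x. h x \<le> 1"
      "\<And>x. x \<in> K \<Longrightarrow> h x = 1" and L: "compact L" "\<And>x. x \<notin> L \<Longrightarrow> h x = 0"
      using bump_function[OF lc K(1) open_UNIV subset_UNIV] by metis
    \<comment> \<open>The cut-off of F has compact support, so \<open>m\<close> annihilates it.
      Subtracting it from F keeps the value 1 and makes the function vanish on
      \<open>K\<close>.\<close>
    let ?f = "\<lambda>x. complex_of_real (h x) * apply_bcontfun F x"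
    have "right_uniformly_continuous ?f"
      using h(1) L by (intro right_uniformly_continuous_compact_support[OF lc _ L(1)]
          continuous_intros continuous_on_apply_bcontfun) simp_all
    moreover have "bounded (range ?f)"
    proof (rule boundedI)
      fix y assume "y \<in> range ?f"
      then obtain x where x: "y = ?f x" by blast
      show "norm y \<le> 1 * norm F"
        unfolding x norm_mult using h(2,3)[of x] by (intro mult_mono norm_bounded) auto
    qed
    ultimately obtain Fh where Fh: "Fh \<in> LUC (+)" "apply_bcontfun Fh = ?f"
      by (rule right_uniformly_continuous_in_LUC[OF lc])
    let ?g = "F - Fh"
    have g: "?g \<in> LUC (+)"
      by (rule diff_in_LUC[OF g_space_plus[OF lc] F(1) Fh(1)])
    have "norm ?g \<le> 1"
    proof (rule norm_bound)
      fix x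
      obtain r where r: "r \<in> {0..1}" "apply_bcontfun F x = complex_of_real r"
        using F(2) by blast
      have "apply_bcontfun ?g x = complex_of_real ((1 - h x) * r)"
        by (simp add: Fh(2) r(2) algebra_simps)
      moreover have "\<bar>(1 - h x) * r\<bar> \<le> 1"
        using r(1) h(2,3)[of x] by (simp add: abs_mult mult_le_one)
      ultimately show "norm (apply_bcontfun ?g x) \<le> 1"
        by (simp only: norm_of_real)
    qed
    moreover have "norm (m' ?g) \<le> 4 * (1 / 8) * norm ?g"
    proof -
      have "norm (complex_integral \<mu> (apply_bcontfun ?g)) \<le> 4 * (1 / 8) * norm ?g"
        using K by (intro norm_complex_integral_le[OF mu(1), of K])
          (auto simp: borel_closed compact_imp_closed Fh(2) h(4))
      then show ?thesis
        using g by (simp add: mu(3) measure_functional_def)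
    qed
    moreover have "m' ?g = 1"
    proof -
      have "m Fh = 0"
        using L(2) by (intro m(6)[OF L(1)]) (simp add: Fh(2))
      moreover have "m F = m ?g + m Fh"
        using m(2)[of ?g Fh] by simp
      ultimately show ?thesis
        using g m(4) by (simp add: m'_def)
    qed
    ultimately show False
      by simp
  qed
  ultimately show ?thesis
    using measure_functionals_subset_top_centre[OF lc G] by blast
qed

end
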